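(* Let $n,m\geq 1$ be integers with $n+m\geq 3$, set $d=m+n$, and let $\Theta$ be a real $n\times m$ matrix, with first uniform Diophantine exponent $\alpha_1$ and second uniform Diophantine exponent $\alpha_2$ (defined in the context). If $m=1$, then \[ \alpha_2\geq(1-\alpha_1)^{-1}-\frac{n-2}{n-1}\,. \] If $m\geq 2$, then \[ \alpha_2\geq\frac{n-1}{-n-(d-2)(1-\alpha_1)^{-1}}\quad\text{if }\alpha_1\leq 1,\qquad \alpha_2\geq\frac{m-1}{n+(d-2)(\alpha_1-1)^{-1}}\quad\text{if }\alpha_1\geq 1. \]
   Context: $|\cdot|$ denotes the sup-norm. Let $\pmb\ell_1,\ldots,\pmb\ell_m\in\mathbb R^d$ be the columns of the $d\times m$ matrix $\begin{pmatrix}E_m\\ \Theta\end{pmatrix}$, $E_m$ the $m\times m$ identity matrix. For a $k$-element subset $\sigma=\{i_1<\dots<i_k\}$ of $\{1,\ldots,m\}$ put $\vec L_\sigma=\pmb\ell_{i_1}\wedge\dots\wedge\pmb\ell_{i_k}$, and $\vec L_\varnothing=1$; let $\mathcal J_k$ be the set of $k$-element subsets of $\{1,\ldots,m\}$. Exterior powers of $\mathbb R^d$ carry the sup-norm of coordinates with respect to the standard basis $\vec e_{j_1}\wedge\dots\wedge\vec e_{j_q}$, and $\wedge^p(\mathbb Z^d)$ denotes the $p$-vectors with integer coordinates in that basis. For $1\le p\le d-1$ put $k_0=\max(0,m-p)$. The $p$-th uniform Diophantine exponent $\alpha_p$ of $\Theta$ is the supremum of real $\gamma$ such that for every sufficiently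 large $t$ the system $\max_{\sigma\in\mathcal J_k}|\vec L_\sigma\wedge\vec Z|\leq t^{1-(k-k_0)(1+\gamma)}$, $k=0,\ldots,m$, has a nonzero solution $\vec Z\in\wedge^p(\mathbb Z^d)$. (For $p=1$ this coincides with the classical uniform exponent: the supremum of $\gamma$ such that for all large $t$ the system $|\vec x|\le t$, $|\Theta\vec x-\vec y|\le t^{-\gamma}$ has a nonzero solution $(\vec x,\vec y)\in\mathbb Z^m\oplus\mathbb Z^n$.) Exponents may be $+\infty$; natural conventions such as $\infty^{-1}=0$, $0^{-1}=\infty$ are used. *)

theory Defs
  imports Complex_Main "HOL-Library.Extended_Real" "Jordan_Normal_Form.Matrix"
begin

text \<open>
  Coordinates are indexed from 0: the standard basis of \<open>\<real>\<^sup>d\<close> is \<open>e 0, \<dots>, e (d-1)\<close>.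
  An element \<open>X\<close> of the exterior algebra of \<open>\<real>\<^sup>d\<close> is represented by its coordinates:
  for \<open>J = {j\<^sub>1 < \<dots> < j\<^sub>q} \<subseteq> {..<d}\<close>, \<open>X J\<close> is the coefficient
  of \<open>e j\<^sub>1 \<and> \<dots> \<and> e j\<^sub>q\<close>.
\<close>

type_synonym multivector = "nat set \<Rightarrow> real"

definition ext_power :: "nat \<Rightarrow> nat \<Rightarrow> multivector set" where
  "ext_power d p = {X. \<forall>J. X J \<noteq> 0 \<longrightarrow> J \<subseteq> {..<d} \<and> card J = p}"

definition ext_lattice :: "nat \<Rightarrow> nat \<Rightarrow> multivector set" where
  "ext_lattice d p = {X \<in> ext_power d p. \<forall>J. X J \<in> \<int>}"

text \<open>For disjoint \<open>A\<close> and \<open>B\<close>, \<open>e\<^sub>A \<and> e\<^sub>B = wedge_sign A B \<cdot> e\<^sub>A\<^sub>\<union>\<^sub>B\<close>: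
  the sign of the permutation sorting the concatenation of \<open>A\<close> and \<open>B\<close>.\<close>

definition wedge_sign :: "nat set \<Rightarrow> nat set \<Rightarrow> real" where
  "wedge_sign A B = (-1) ^ card {(a, b) \<in> A \<times> B. b < a}"

definition wedge :: "multivector \<Rightarrow> multivector \<Rightarrow> multivector" where
  "wedge X Y = (\<lambda>J. \<Sum>A\<in>Pow J. wedge_sign A (J - A) * X A * Y (J - A))"

definition mv_one :: multivector where
  "mv_one = (\<lambda>J. if J = {} then 1 else 0)"

definition mv_of_vec :: "real vec \<Rightarrow> multivector" where
  "mv_of_vec v = (\<lambda>J. \<Sum>i<dim_vec v. if J = {i} then v $ i else 0)"

text \<open>The maximum below runs over the coordinates of all degrees, so for \<open>X \<in> ext_power d q\<close>
  it is the sup-norm on the \<open>q\<close>-th exterior power, and it is 0 when \<open>q > d\<close>.\<close>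

definition sup_norm :: "nat \<Rightarrow> multivector \<Rightarrow> real" where
  "sup_norm d X = (MAX J\<in>Pow {..<d}. \<bar>X J\<bar>)"

definition ell :: "real mat \<Rightarrow> nat \<Rightarrow> real vec" where
  "ell \<Theta> i = col (1\<^sub>m (dim_col \<Theta>) @\<^sub>r \<Theta>) i"

definition L_mv :: "real mat \<Rightarrow> nat set \<Rightarrow> multivector" where
  "L_mv \<Theta> \<sigma> = foldr (\<lambda>i. wedge (mv_of_vec (ell \<Theta> i))) (sorted_list_of_set \<sigma>) mv_one"

definition index_sets :: "nat \<Rightarrow> nat \<Rightarrow> nat set set" where
  "index_sets m k = {\<sigma>. \<sigma> \<subseteq> {..<m} \<and> card \<sigma> = k}"

definition uniform_admissible :: "nat \<Rightarrow> real mat \<Rightarrow> real \<Rightarrow> bool" where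
  "uniform_admissible p \<Theta> \<gamma> \<longleftrightarrow>
    (let m = dim_col \<Theta>; d = m + dim_row \<Theta>; k\<^sub>0 = max 0 (real m - real p) in
      \<forall>\<^sub>F t :: real in at_top. \<exists>Z \<in> ext_lattice d p. Z \<noteq> (\<lambda>_. 0) \<and>
        (\<forall>k\<le>m. (MAX \<sigma>\<in>index_sets m k. sup_norm d (wedge (L_mv \<Theta> \<sigma>) Z))
                  \<le> t powr (1 - (real k - k\<^sub>0) * (1 + \<gamma>))))"

definition uniform_exponent :: "nat \<Rightarrow> real mat \<Rightarrow> ereal" where
  "uniform_exponent p \<Theta> = Sup (ereal ` {\<gamma>. uniform_admissible p \<Theta> \<gamma>})"

end

theory Submission
  imports Defs "HOL-Library.FuncSet"
begin

text \<open>
  Put \<open>\<kappa> = m/n\<close> and consider the flow that multiplies \<open>x\<close> by \<open>exp (- s)\<close> and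
  \<open>y - \<Theta> x\<close> by \<open>exp (\<kappa> s)\<close>. Let \<open>exp a \<le> exp b\<close> be the first two successive minima of the
  integer lattice at time \<open>s\<close>, attained at \<open>z\<close> and \<open>w\<close>. Since \<open>z \<and> w\<close> solves the system
  defining \<open>\<alpha>\<^sub>2\<close>, it suffices to bound \<open>a + b\<close> from above by a linear function of \<open>s\<close>.
  One constraint is \<open>a + (d - 1) b \<le> C\<close>, the part of Minkowski's second theorem that a pigeonhole
  argument yields. For the other one, follow the flow (forward if \<open>z\<close> is expanding, backward if it
  is contracting) for the time \<open>\<delta> = (b - a) / (1 + \<kappa>)\<close> that \<open>z\<close> needs to grow as long as the
  shortest vector not parallel to it could have become: there no lattice vector is shorter than
  \<open>exp (b - \<delta>)\<close>, respectively \<open>exp (a + \<delta>)\<close>, and the uniform exponent \<open>\<gamma>\<close> of \<open>\<Theta>\<close> bounds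
  this length. The result is \<open>a + \<gamma> b \<le> (\<kappa> - \<gamma>) s + C\<close> or
  \<open>\<gamma> a + b \<le> (\<kappa> - \<gamma>) s + C\<close>. Combining the two constraints linearly and letting \<open>\<gamma>\<close>
  tend to \<open>\<alpha>\<^sub>1\<close> gives the theorem.
\<close>

section \<open>Exterior algebra\<close>

text \<open>The choice \<kappa> = m/n makes the flow volume preserving, so the pigeonhole bound does
  not depend on time. Exponents become slopes: if shortest vectors have logarithm at most c s, up to
  a constant, then 1 + \<gamma> = (1 + \<kappa>) / (1 + c); for pairs, 1 + c is replaced by 2 plus
  the slope of a + b, up to a shift for m = 1. The direction of the flow is chosen to lengthen z at
  the full rate of its dominant coordinate, and its multiples with it, while every other vector
  shrinks at a bounded rate; \<delta> is the time at which these two lower bounds meet. The obstacle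
  lies at the lower end of the range: the first exponent may equal \<kappa>, and then no \<gamma>
  from \<kappa> on lies below it. Therefore \<open>dominated\<close> is established for \<kappa>
  itself by pigeonhole. The same bound shows that the first exponent is at least \<kappa>, so that
  only \<gamma> with \<kappa> - \<gamma> \<le> 0 have to be considered; this sign decides which of
  the two alternatives is the worse one.\<close>

lemma wedge_infinite: "infinite J \<Longrightarrow> wedge X Y J = 0"
  by (simp add: wedge_def)

lemma wedge_scale_right: "wedge X (\<lambda>J. c * Y J) = (\<lambda>J. c * wedge X Y J)"
  by (rule ext) (auto simp: wedge_def sum_distrib_left mult_ac intro!: sum.cong)

lemma wedge_scale_left: "wedge (\<lambda>J. c * X J) Y = (\<lambda>J. c * wedge X Y J)"
  by (rule ext) (auto simp: wedge_def sum_distrib_left mult_ac intro!: sum.cong)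

lemma wedge_sum_right: "wedge X (\<lambda>J. \<Sum>i\<in>I. Y i J) = (\<lambda>J. \<Sum>i\<in>I. wedge X (Y i) J)"
  by (rule ext) (unfold wedge_def sum_distrib_left, rule sum.swap)

lemma wedge_sum_left: "wedge (\<lambda>J. \<Sum>i\<in>I. X i J) Y = (\<lambda>J. \<Sum>i\<in>I. wedge (X i) Y J)"
  by (rule ext) (unfold wedge_def sum_distrib_left sum_distrib_right, rule sum.swap)

lemma wedge_zero_left: "wedge (\<lambda>_. 0) Y = (\<lambda>_. 0)"
  by (rule ext) (simp add: wedge_def)

lemma wedge_zero_right: "wedge X (\<lambda>_. 0) = (\<lambda>_. 0)"
  by (rule ext) (simp add: wedge_def)

text \<open>Inversions against a disjoint union add up, so the sign is multiplicative in each
  argument; associativity rests on this.\<close>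

lemma wedge_sign_Un_left:
  assumes "finite A" "finite B" "finite C" "A \<inter> B = {}"
  shows "wedge_sign (A \<union> B) C = wedge_sign A C * wedge_sign B C"
proof -
  have "{(a, b) \<in> (A \<union> B) \<times> C. b < a} = {(a, b) \<in> A \<times> C. b < a} \<union> {(a, b) \<in> B \<times> C. b < a}"
    by auto
  moreover have "finite {(a, b) \<in> A \<times> C. b < a}" "finite {(a, b) \<in> B \<times> C. b < a}"
    using assms by (auto intro: finite_subset[OF _ finite_cartesian_product])
  moreover have "{(a, b) \<in> A \<times> C. b < a} \<inter> {(a, b) \<in> B \<times> C. b < a} = {}"
    using assms(4) by auto
  ultimately show ?thesis
    by (simp add: wedge_sign_def card_Un_disjoint power_add)
qed

lemma wedge_sign_Un_right:
  assumes "finite A" "finite B" "finite C" "B \<inter> C = {}"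
  shows "wedge_sign A (B \<union> C) = wedge_sign A B * wedge_sign A C"
proof -
  have "{(a, b) \<in> A \<times> (B \<union> C). b < a} = {(a, b) \<in> A \<times> B. b < a} \<union> {(a, b) \<in> A \<times> C. b < a}"
    by auto
  moreover have "finite {(a, b) \<in> A \<times> B. b < a}" "finite {(a, b) \<in> A \<times> C. b < a}"
    using assms by (auto intro: finite_subset[OF _ finite_cartesian_product])
  moreover have "{(a, b) \<in> A \<times> B. b < a} \<inter> {(a, b) \<in> A \<times> C. b < a} = {}"
    using assms(4) by auto
  ultimately show ?thesis
    by (simp add: wedge_sign_def card_Un_disjoint power_add)
qed

lemma abs_wedge_sign [simp]: "\<bar>wedge_sign A B\<bar> = 1"
  by (simp add: wedge_sign_def power_abs)

lemma wedge_sign_empty [simp]: "wedge_sign {} B = 1" "wedge_sign A {} = 1"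
  by (simp_all add: wedge_sign_def)

lemma wedge_sign_Ints: "wedge_sign A B \<in> \<int>"
  by (simp add: wedge_sign_def)

lemma wedge_sign_singletons: "wedge_sign {a} {b} = (if b < a then - 1 else 1)"
proof -
  have "{(x, y) \<in> {a} \<times> {b}. y < x} = (if b < a then {(a, b)} else {})"
    by auto
  then show ?thesis
    by (simp add: wedge_sign_def)
qed

text \<open>Both sides sum over the ordered partitions of \<open>J\<close> into three sets, weighted
  by the product of the three pairwise signs; a chain of \<open>B\<close> in \<open>A\<close> in
  \<open>J\<close> corresponds to the parts \<open>B\<close>, \<open>A - B\<close> and
  \<open>J - A\<close>.\<close>

lemma wedge_assoc: "wedge (wedge X Y) Z = wedge X (wedge Y Z)"
proof
  fix J :: "nat set"
  show "wedge (wedge X Y) Z J = wedge X (wedge Y Z) J"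
  proof (cases "finite J")
    case True
    then have fin: "finite A" if "A \<subseteq> J" for A
      using that finite_subset by blast
    let ?f = "\<lambda>(A, B). wedge_sign A (J - A) * wedge_sign B (A - B) * X B * Y (A - B) * Z (J - A)"
    let ?g = "\<lambda>(B, C). wedge_sign B (J - B) * wedge_sign C (J - B - C) * X B * Y C * Z (J - B - C)"
    have "wedge (wedge X Y) Z J = (\<Sum>A\<in>Pow J. \<Sum>B\<in>Pow A. ?f (A, B))"
      by (auto simp: wedge_def sum_distrib_left sum_distrib_right mult_ac intro!: sum.cong)
    also have "\<dots> = sum ?f (SIGMA A:Pow J. Pow A)"
      using True fin by (subst sum.Sigma) auto
    also have "\<dots> = sum ?g (SIGMA B:Pow J. Pow (J - B))"
    proof (rule sum.reindex_bij_witness[where i = "\<lambda>(B, C). (B \<union> C, B)"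
          and j = "\<lambda>(A, B). (B, A - B)"], goal_cases)
      case (5 p)
      then obtain A B where p: "p = (A, B)" and AB: "A \<subseteq> J" "B \<subseteq> A"
        by auto
      have "wedge_sign A (J - A) = wedge_sign B (J - A) * wedge_sign (A - B) (J - A)"
        using wedge_sign_Un_left[of B "A - B" "J - A"] AB fin finite_subset[OF AB(2)]
        by (simp add: Un_absorb1)
      moreover have "wedge_sign B (J - B) = wedge_sign B (A - B) * wedge_sign B (J - A)"
      proof -
        have "J - B = (A - B) \<union> (J - A)"
          using AB by auto
        moreover have "wedge_sign B ((A - B) \<union> (J - A)) = wedge_sign B (A - B) * wedge_sign B (J - A)"
          using AB fin by (intro wedge_sign_Un_right) auto
        ultimately show ?thesis
          by simp
      qed
      moreover have "J - B - (A - B) = J - A"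
        using AB by auto
      ultimately show ?case
        by (simp add: p)
    qed auto
    also have "\<dots> = (\<Sum>B\<in>Pow J. \<Sum>C\<in>Pow (J - B). ?g (B, C))"
      using True fin by (subst sum.Sigma) auto
    also have "\<dots> = wedge X (wedge Y Z) J"
      by (auto simp: wedge_def sum_distrib_left sum_distrib_right mult_ac intro!: sum.cong)
    finally show ?thesis .
  qed (simp add: wedge_infinite)
qed

text \<open>Points are functions on the naturals instead of vectors of a fixed dimension, which
  spares dimension conditions; values from \<open>d\<close> on are ignored.\<close>

definition vec_mv :: "nat \<Rightarrow> (nat \<Rightarrow> real) \<Rightarrow> multivector" where
  "vec_mv d v = mv_of_vec (vec d v)"

lemma vec_mv_singleton: "vec_mv d v {i} = (if i < d then v i else 0)"
  by (simp add: vec_mv_def mv_of_vec_def sum.delta' singleton_inject if_distrib cong: if_cong)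

lemma vec_mv_nonzeroD: "vec_mv d v J \<noteq> 0 \<Longrightarrow> \<exists>i<d. J = {i}"
  unfolding vec_mv_def mv_of_vec_def by (rule ccontr) (auto intro!: sum.neutral)

text \<open>Replacing \<open>A\<close> by its complement in \<open>J\<close> exchanges the factors,
  and the sign of two distinct singletons changes under the swap.\<close>

lemma vec_mv_anticommute:
  "wedge (vec_mv d v) (vec_mv d w) = (\<lambda>J. - wedge (vec_mv d w) (vec_mv d v) J)"
proof
  fix J :: "nat set"
  have "wedge_sign A (J - A) * vec_mv d v A * vec_mv d w (J - A)
      = - (wedge_sign (J - A) A * vec_mv d w (J - A) * vec_mv d v A)" if "A \<subseteq> J" for A
  proof (cases "vec_mv d v A = 0 \<or> vec_mv d w (J - A) = 0")
    case False
    then obtain a b where ab: "A = {a}" "J - A = {b}"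
      using vec_mv_nonzeroD by meson
    then have "a \<noteq> b"
      by auto
    then show ?thesis
      by (simp only: ab(2)) (simp add: ab(1) wedge_sign_singletons)
  qed auto
  then have "wedge (vec_mv d v) (vec_mv d w) J
      = (\<Sum>A\<in>Pow J. - (wedge_sign (J - A) A * vec_mv d w (J - A) * vec_mv d v A))"
    unfolding wedge_def by (intro sum.cong) auto
  also have "\<dots> = (\<Sum>A\<in>Pow J. - (wedge_sign A (J - A) * vec_mv d w A * vec_mv d v (J - A)))"
    by (rule sum.reindex_bij_witness[where i = "\<lambda>A. J - A" and j = "\<lambda>A. J - A"])
      (auto simp: double_diff)
  finally show "wedge (vec_mv d v) (vec_mv d w) J = - wedge (vec_mv d w) (vec_mv d v) J"
    by (simp add: wedge_def sum_negf)
qed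

lemma vec_mv_wedge_self: "wedge (vec_mv d v) (vec_mv d v) = (\<lambda>_. 0)"
  using fun_cong[OF vec_mv_anticommute[of d v v]] by auto

text \<open>These minors are how nonparallel points are later seen to have a nonzero
  product.\<close>

lemma vec_mv_wedge_pair:
  assumes "i < j" "j < d"
  shows "wedge (vec_mv d v) (vec_mv d w) {i, j} = v i * w j - v j * w i"
proof -
  have P: "Pow {i, j} = {{}, {i}, {j}, {i, j}}"
    by auto
  have 0: "vec_mv d v {} = 0" "vec_mv d w {} = 0"
    using vec_mv_nonzeroD by blast+
  have D: "{i, j} - {i} = {j}" "{i, j} - {j} = {i}"
    using assms by auto
  have "{i} \<noteq> {j}" "{i} \<noteq> {i, j}" "{j} \<noteq> {i, j}" "{i} \<noteq> {}" "{j} \<noteq> {}" "{i, j} \<noteq> {}"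
    using assms by auto
  then show ?thesis
    unfolding wedge_def P using assms
    by (simp add: 0 D vec_mv_singleton wedge_sign_singletons)
qed

lemma vec_mv_ext_lattice:
  assumes "\<And>i. v i \<in> \<int>"
  shows "vec_mv d v \<in> ext_lattice d 1"
proof -
  have "vec_mv d v J \<in> \<int>" for J
    using vec_mv_nonzeroD[of d v J] assms by (cases "vec_mv d v J = 0") (auto simp: vec_mv_singleton)
  then show ?thesis
    unfolding ext_lattice_def ext_power_def using vec_mv_nonzeroD by fastforce
qed

lemma wedge_ext_lattice:
  assumes X: "X \<in> ext_lattice d p" and Y: "Y \<in> ext_lattice d q"
  shows "wedge X Y \<in> ext_lattice d (p + q)"
proof -
  have "J \<subseteq> {..<d} \<and> card J = p + q" if "wedge X Y J \<noteq> 0" for J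
  proof -
    have "\<exists>A\<in>Pow J. wedge_sign A (J - A) * X A * Y (J - A) \<noteq> 0"
      using that unfolding wedge_def by (meson sum.neutral)
    then obtain A where A: "A \<subseteq> J" "X A \<noteq> 0" "Y (J - A) \<noteq> 0"
      by auto
    then have *: "A \<subseteq> {..<d}" "card A = p" "J - A \<subseteq> {..<d}" "card (J - A) = q"
      using X Y by (auto simp: ext_lattice_def ext_power_def)
    then have fin: "finite A" "finite (J - A)"
      by (meson finite_lessThan finite_subset)+
    have "J = A \<union> (J - A)"
      using A(1) by auto
    then show ?thesis
      using * fin card_Un_disjoint[of A "J - A"] by auto
  qed
  moreover have "wedge X Y J \<in> \<int>" for J
    using X Y unfolding wedge_def ext_lattice_def by (auto intro!: Ints_sum Ints_mult wedge_sign_Ints)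
  ultimately show ?thesis
    by (auto simp: ext_lattice_def ext_power_def)
qed

text \<open>\<open>L_mv\<close> for an arbitrary family and an arbitrary list of indices, the form
  that admits induction over the list.\<close>

definition wedge_list :: "nat \<Rightarrow> (nat \<Rightarrow> nat \<Rightarrow> real) \<Rightarrow> nat list \<Rightarrow> multivector" where
  "wedge_list d b xs = foldr (\<lambda>i. wedge (vec_mv d (b i))) xs mv_one"

lemma wedge_list_simps [simp]:
  "wedge_list d b [] = mv_one"
  "wedge_list d b (i # xs) = wedge (vec_mv d (b i)) (wedge_list d b xs)"
  by (simp_all add: wedge_list_def)

text \<open>The condition on \<open>X\<close> is forced: on an infinite set \<open>wedge\<close> is
  a sum over an infinite \<open>Pow J\<close>, hence 0 by default.\<close>

lemma wedge_one_left: "(\<And>J. infinite J \<Longrightarrow> X J = 0) \<Longrightarrow> wedge mv_one X = X"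
proof
  fix J assume inf: "\<And>J. infinite J \<Longrightarrow> X J = 0"
  show "wedge mv_one X J = X J"
  proof (cases "finite J")
    case True
    have "wedge mv_one X J = (\<Sum>A\<in>Pow J. if A = {} then X J else 0)"
      unfolding wedge_def by (intro sum.cong) (auto simp: mv_one_def)
    then show ?thesis
      using True by simp
  qed (simp add: inf wedge_infinite)
qed

lemma wedge_one_right: "(\<And>J. infinite J \<Longrightarrow> X J = 0) \<Longrightarrow> wedge X mv_one = X"
proof
  fix J assume inf: "\<And>J. infinite J \<Longrightarrow> X J = 0"
  show "wedge X mv_one J = X J"
  proof (cases "finite J")
    case True
    have "wedge X mv_one J = (\<Sum>A\<in>Pow J. if A = J then X J else 0)"
      unfolding wedge_def by (intro sum.cong) (auto simp: mv_one_def)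
    then show ?thesis
      using True by simp
  qed (simp add: inf wedge_infinite)
qed

lemma vec_mv_infinite: "infinite J \<Longrightarrow> vec_mv d v J = 0"
  using vec_mv_nonzeroD by blast

text \<open>The factor is \<open>(-1) ^ length xs\<close>. Its existence is enough to move a
  repeated vector next to its copy in \<open>wedge_list_absorb\<close>.\<close>

lemma wedge_list_commute:
  "\<exists>\<epsilon>. \<forall>v. wedge (wedge_list d b xs) (vec_mv d v) = (\<lambda>J. \<epsilon> * wedge (vec_mv d v) (wedge_list d b xs) J)"
proof (induction xs)
  case Nil
  show ?case
    by (intro exI[of _ 1]) (simp add: wedge_one_left wedge_one_right vec_mv_infinite)
next
  case (Cons i xs)
  then obtain \<epsilon> where \<epsilon>: "\<And>v. wedge (wedge_list d b xs) (vec_mv d v)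
      = (\<lambda>J. \<epsilon> * wedge (vec_mv d v) (wedge_list d b xs) J)"
    by blast
  have "wedge (wedge_list d b (i # xs)) (vec_mv d v)
      = (\<lambda>J. (- \<epsilon>) * wedge (vec_mv d v) (wedge_list d b (i # xs)) J)" for v
  proof -
    have "wedge (wedge_list d b (i # xs)) (vec_mv d v)
        = (\<lambda>J. \<epsilon> * wedge (wedge (vec_mv d (b i)) (vec_mv d v)) (wedge_list d b xs) J)"
      by (simp add: wedge_assoc \<epsilon> wedge_scale_right)
    also have "wedge (vec_mv d (b i)) (vec_mv d v)
        = (\<lambda>J. (-1) * wedge (vec_mv d v) (vec_mv d (b i)) J)"
      by (subst vec_mv_anticommute) simp
    finally show ?thesis
      by (simp add: wedge_scale_left[of "-1", simplified] wedge_assoc)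
  qed
  then show ?case
    by (intro exI allI)
qed

lemma wedge_list_absorb:
  assumes "l \<in> set xs"
  shows "wedge (wedge_list d b xs) (vec_mv d (b l)) = (\<lambda>_. 0)"
  using assms
proof (induction xs)
  case (Cons i xs)
  show ?case
  proof (cases "l \<in> set xs")
    case True
    then show ?thesis
      using Cons.IH by (simp add: wedge_assoc wedge_zero_right)
  next
    case False
    then have l: "l = i"
      using Cons.prems by simp
    obtain \<epsilon> where \<epsilon>: "wedge (wedge_list d b xs) (vec_mv d (b i))
        = (\<lambda>J. \<epsilon> * wedge (vec_mv d (b i)) (wedge_list d b xs) J)"
      using wedge_list_commute by blast
    have "wedge (wedge_list d b (i # xs)) (vec_mv d (b i))
        = (\<lambda>J. \<epsilon> * wedge (wedge (vec_mv d (b i)) (vec_mv d (b i))) (wedge_list d b xs) J)"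
      by (simp add: wedge_assoc \<epsilon> wedge_scale_right)
    then show ?thesis
      by (simp add: l vec_mv_wedge_self wedge_zero_left)
  qed
qed simp

text \<open>Coordinates indexed within \<open>{..<m}\<close> see only the first \<open>m\<close>
  entries of the factors, which form an identity matrix; the increasing order of the list makes the
  sign 1.\<close>

lemma wedge_list_leading:
  assumes "sorted_wrt (<) xs" "set xs \<subseteq> {..<m}" "m \<le> d" "A \<subseteq> {..<m}"
    and b: "\<And>i l. i < m \<Longrightarrow> l < m \<Longrightarrow> b l i = (if i = l then 1 else 0)"
  shows "wedge_list d b xs A = (if A = set xs then 1 else 0)"
  using assms(1,2,4)
proof (induction xs arbitrary: A)
  case Nil
  then show ?case
    by (simp add: mv_one_def)
next
  case (Cons l xs)
  have fin: "finite A"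
    using Cons.prems(3) finite_subset by blast
  have "l < m"
    using Cons.prems(2) by simp
  have v: "vec_mv d (b l) B = (if B = {l} then 1 else 0)" if "B \<subseteq> A" for B
  proof (cases "vec_mv d (b l) B = 0")
    case True
    then show ?thesis
      using \<open>l < m\<close> \<open>m \<le> d\<close> b[of l l] by (auto simp: vec_mv_singleton)
  next
    case False
    then obtain i where i: "B = {i}" "i < d"
      using vec_mv_nonzeroD by blast
    moreover have "i < m"
      using i that Cons.prems(3) by auto
    ultimately show ?thesis
      using b[of i l] \<open>l < m\<close> by (simp add: vec_mv_singleton)
  qed
  have "wedge_list d b (l # xs) A = (\<Sum>B\<in>Pow A. if B = {l} then
      wedge_sign {l} (A - {l}) * wedge_list d b xs (A - {l}) else 0)"
    unfolding wedge_list_simps wedge_def by (intro sum.cong refl) (simp add: v)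
  also have "\<dots> = (if l \<in> A then wedge_sign {l} (A - {l}) * wedge_list d b xs (A - {l}) else 0)"
    using fin by (subst sum.delta) auto
  also have "\<dots> = (if l \<in> A \<and> A - {l} = set xs then wedge_sign {l} (set xs) else 0)"
  proof -
    have "wedge_list d b xs (A - {l}) = (if A - {l} = set xs then 1 else 0)"
    proof (rule Cons.IH)
      show "sorted_wrt (<) xs"
        using Cons.prems(1) by simp
      show "set xs \<subseteq> {..<m}"
        using Cons.prems(2) by simp
      show "A - {l} \<subseteq> {..<m}"
        using Cons.prems(3) by blast
    qed
    then show ?thesis
      by (cases "A - {l} = set xs") (simp_all only: if_True if_False mult_1_right mult_zero_right simp_thms if_cancel)
  qed
  also have "wedge_sign {l} (set xs) = 1"
  proof -
    have "{(a, b) \<in> {l} \<times> set xs. b < a} = {}"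
      using Cons.prems(1) by auto
    then show ?thesis
      unfolding wedge_sign_def by (simp only: card.empty power_0)
  qed
  also have "l \<in> A \<and> A - {l} = set xs \<longleftrightarrow> A = set (l # xs)"
    using Cons.prems(1) by auto
  finally show ?case
    by simp
qed

lemma sup_norm_le_iff: "sup_norm d X \<le> B \<longleftrightarrow> (\<forall>J\<subseteq>{..<d}. \<bar>X J\<bar> \<le> B)"
proof -
  have "finite ((\<lambda>J. \<bar>X J\<bar>) ` Pow {..<d})" "(\<lambda>J. \<bar>X J\<bar>) ` Pow {..<d} \<noteq> {}"
    by auto
  then show ?thesis
    unfolding sup_norm_def by (subst Max_le_iff) auto
qed

lemma abs_le_sup_norm: "J \<subseteq> {..<d} \<Longrightarrow> \<bar>X J\<bar> \<le> sup_norm d X"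
  using sup_norm_le_iff[of d X "sup_norm d X"] by simp

lemma sup_norm_nonneg: "0 \<le> sup_norm d X"
  using abs_le_sup_norm[of "{}" d X] by simp

section \<open>Coordinates adapted to the columns\<close>

text \<open>Laplace expansion along the last factor. It extracts single entries of a point from its
  product with \<open>L_mv\<close>.\<close>

lemma wedge_vec_mv_expand:
  assumes "J \<subseteq> {..<d}"
  shows "wedge W (vec_mv d v) J = (\<Sum>i\<in>J. wedge_sign (J - {i}) {i} * W (J - {i}) * v i)"
proof -
  have fin: "finite J"
    using assms finite_subset by blast
  have "wedge W (vec_mv d v) J
      = (\<Sum>A\<in>(\<lambda>i. J - {i}) ` J. wedge_sign A (J - A) * W A * vec_mv d v (J - A))"
    unfolding wedge_def
  proof (rule sum.mono_neutral_right)
    show "\<forall>A\<in>Pow J - (\<lambda>i. J - {i}) ` J. wedge_sign A (J - A) * W A * vec_mv d v (J - A) = 0"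
    proof
      fix A assume A: "A \<in> Pow J - (\<lambda>i. J - {i}) ` J"
      have "vec_mv d v (J - A) = 0"
      proof (rule ccontr)
        assume "vec_mv d v (J - A) \<noteq> 0"
        then obtain i where i: "J - A = {i}"
          using vec_mv_nonzeroD by meson
        then have "i \<in> J" "A = J - {i}"
          using A by auto
        then show False
          using A by blast
      qed
      then show "wedge_sign A (J - A) * W A * vec_mv d v (J - A) = 0"
        by simp
    qed
  qed (use fin in auto)
  also have "\<dots> = (\<Sum>i\<in>J. wedge_sign (J - {i}) (J - (J - {i})) * W (J - {i}) * vec_mv d v (J - (J - {i})))"
    by (subst sum.reindex) (auto simp: inj_on_def)
  also have "\<dots> = (\<Sum>i\<in>J. wedge_sign (J - {i}) {i} * W (J - {i}) * v i)"
  proof (rule sum.cong)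
    fix i assume "i \<in> J"
    then have "J - (J - {i}) = {i}" "i < d"
      using assms by auto
    then show "wedge_sign (J - {i}) (J - (J - {i})) * W (J - {i}) * vec_mv d v (J - (J - {i}))
        = wedge_sign (J - {i}) {i} * W (J - {i}) * v i"
      by (simp add: vec_mv_singleton)
  qed simp
  finally show ?thesis .
qed

section \<open>The basis of columns, the flow and the integer lattice\<close>

locale theta_matrix =
  fixes n m :: nat and \<Theta> :: "real mat"
  assumes n_pos: "1 \<le> n" and m_pos: "1 \<le> m" and Theta_carrier: "\<Theta> \<in> carrier_mat n m"
begin

abbreviation d :: nat where "d \<equiv> m + n"

definition \<kappa> :: real where "\<kappa> = real m / real n"

text \<open>The columns completed by the last \<open>n\<close> standard vectors to a basis of
  determinant 1. In it, a product with \<open>L_mv \<Theta> \<sigma>\<close> loses all terms with an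
  index in \<sigma>.\<close>

definition basis :: "nat \<Rightarrow> nat \<Rightarrow> real" where
  "basis l i = (if i = l then 1 else if l < m \<and> m \<le> i then \<Theta> $$ (i - m, l) else 0)"

text \<open>The coordinates with respect to \<open>basis\<close>, as \<open>coord_expansion\<close>
  confirms.\<close>

definition coord :: "(nat \<Rightarrow> real) \<Rightarrow> nat \<Rightarrow> real" where
  "coord z l = (if l < m then z l else z l - (\<Sum>i<m. \<Theta> $$ (l - m, i) * z i))"

definition wt :: "real \<Rightarrow> nat \<Rightarrow> real" where
  "wt s l = (if l < m then exp (- s) else exp (\<kappa> * s))"

definition height :: "real \<Rightarrow> (nat \<Rightarrow> real) \<Rightarrow> real" where
  "height s z = (MAX l\<in>{..<d}. \<bar>coord z l\<bar> * wt s l)"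

definition lattice :: "(nat \<Rightarrow> real) set" where
  "lattice = {z. (\<forall>i. z i \<in> \<int>) \<and> (\<forall>i\<ge>d. z i = 0)}"

lemma kappa_pos: "0 < \<kappa>"
  using n_pos m_pos by (simp add: \<kappa>_def)

lemma wt_pos: "0 < wt s l"
  by (simp add: wt_def)

lemma height_ge: "l < d \<Longrightarrow> \<bar>coord z l\<bar> * wt s l \<le> height s z"
  unfolding height_def by (rule Max_ge) auto

lemma height_attained: "\<exists>l<d. height s z = \<bar>coord z l\<bar> * wt s l"
proof -
  have "height s z \<in> (\<lambda>l. \<bar>coord z l\<bar> * wt s l) ` {..<d}"
    unfolding height_def using m_pos by (intro Max_in) auto
  then show ?thesis
    by auto
qed

lemma height_nonneg: "0 \<le> height s z"
  using height_attained[of s z] wt_pos[of s] by (auto simp: less_imp_le)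

lemma coord_expansion:
  assumes "i < d"
  shows "z i = (\<Sum>l<d. coord z l * basis l i)"
proof -
  have split: "{..<d} = {..<m} \<union> {m..<d}" "{..<m} \<inter> {m..<d} = {}"
    by auto
  have "(\<Sum>l<d. coord z l * basis l i)
      = (\<Sum>l<m. z l * basis l i) + (\<Sum>l=m..<d. coord z l * basis l i)"
    unfolding split(1) by (subst sum.union_disjoint) (auto simp: coord_def)
  also have "(\<Sum>l=m..<d. coord z l * basis l i) = (\<Sum>l=m..<d. if l = i then coord z i else 0)"
    by (intro sum.cong) (auto simp: basis_def)
  also have "(\<Sum>l<m. z l * basis l i) = (\<Sum>l<m. if i < m then (if l = i then z i else 0)
      else \<Theta> $$ (i - m, l) * z l)"
    by (intro sum.cong) (auto simp: basis_def)
  finally show ?thesis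
    using assms by (auto simp: coord_def)
qed

lemma vec_mv_expansion:
  "vec_mv d z = (\<lambda>J. \<Sum>l<d. coord z l * vec_mv d (basis l) J)"
proof
  fix J
  show "vec_mv d z J = (\<Sum>l<d. coord z l * vec_mv d (basis l) J)"
  proof (cases "\<exists>i<d. J = {i}")
    case True
    then show ?thesis
      using coord_expansion[of _ z] by (auto simp: vec_mv_singleton)
  next
    case False
    then have "vec_mv d v J = 0" for v
      using vec_mv_nonzeroD by blast
    then show ?thesis
      by simp
  qed
qed

lemma ell_eq_basis:
  assumes "l < m"
  shows "ell \<Theta> l = vec d (basis l)"
proof -
  have dim: "dim_row \<Theta> = n" "dim_col \<Theta> = m"
    using Theta_carrier by auto
  have dims: "dim_row (1\<^sub>m m @\<^sub>r \<Theta>) = d" "dim_col (1\<^sub>m m @\<^sub>r \<Theta>) = m"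
    using carrier_append_rows[OF one_carrier_mat Theta_carrier] by auto
  show ?thesis
  proof (rule eq_vecI)
    fix i assume "i < dim_vec (vec d (basis l))"
    then have i: "i < d"
      by simp
    have "(1\<^sub>m m @\<^sub>r \<Theta>) $$ (i, l) = basis l i"
      using i assms dim by (auto simp: append_rows_def basis_def)
    then show "ell \<Theta> l $ i = vec d (basis l) $ i"
      using i assms dim dims by (simp add: ell_def)
  qed (simp add: ell_def dim dims)
qed

lemma L_mv_eq:
  assumes "\<sigma> \<subseteq> {..<m}"
  shows "L_mv \<Theta> \<sigma> = wedge_list d basis (sorted_list_of_set \<sigma>)"
proof -
  have "set (sorted_list_of_set \<sigma>) \<subseteq> {..<m}"
    using assms finite_subset by fastforce
  then show ?thesis
    unfolding L_mv_def wedge_list_def vec_mv_def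
    by (intro foldr_cong) (auto simp: ell_eq_basis)
qed

lemma L_mv_absorb:
  assumes "\<sigma> \<subseteq> {..<m}" "l \<in> \<sigma>"
  shows "wedge (L_mv \<Theta> \<sigma>) (vec_mv d (basis l)) = (\<lambda>_. 0)"
proof -
  have "l \<in> set (sorted_list_of_set \<sigma>)"
    using assms finite_subset[of \<sigma> "{..<m}"] by simp
  then show ?thesis
    using wedge_list_absorb L_mv_eq[OF assms(1)] by simp
qed

lemma L_mv_leading:
  assumes "\<sigma> \<subseteq> {..<m}" "A \<subseteq> {..<m}"
  shows "L_mv \<Theta> \<sigma> A = (if A = \<sigma> then 1 else 0)"
proof -
  have fin: "finite \<sigma>"
    using assms finite_subset by blast
  then have "wedge_list d basis (sorted_list_of_set \<sigma>) A = (if A = set (sorted_list_of_set \<sigma>) then 1 else 0)"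
    using assms by (intro wedge_list_leading[where m = m]) (auto simp: basis_def)
  then show ?thesis
    using fin assms(1) by (simp add: L_mv_eq)
qed

text \<open>Each index from \<open>m\<close> on contributes the factor
  \<open>exp (- (1 + \<kappa>) * s)\<close>. This mirrors the drop of the exponent by 1 + \<gamma>
  per level \<open>k\<close> in \<open>uniform_admissible\<close>.\<close>

lemma inverse_wt: "inverse (wt s l) = exp (s - (if l < m then 0 else 1) * (1 + \<kappa>) * s)"
  by (simp add: wt_def exp_minus[symmetric] algebra_simps)

lemma abs_coord_le:
  assumes "l < d"
  shows "\<bar>coord z l\<bar> \<le> height s z * exp (s - (if l < m then 0 else 1) * (1 + \<kappa>) * s)"
  using height_ge[OF assms, of z s] wt_pos[of s l]
  unfolding inverse_wt[symmetric] by (simp add: field_simps)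

text \<open>With truncated subtraction, \<open>1 - (m - card \<sigma>)\<close> is 1 if \<sigma> is
  all of \<open>{..<m}\<close> and 0 otherwise. In the full case only indices from \<open>m\<close>
  on survive in the product, and these carry the small factor.\<close>

lemma wedge_one_bound:
  obtains K where "0 < K"
    "\<And>s z \<sigma>. 0 \<le> s \<Longrightarrow> \<sigma> \<subseteq> {..<m} \<Longrightarrow> sup_norm d (wedge (L_mv \<Theta> \<sigma>) (vec_mv d z))
     \<le> K * (height s z * exp (s - real (1 - (m - card \<sigma>)) * (1 + \<kappa>) * s))"
proof -
  define N where "N \<sigma> l = sup_norm d (wedge (L_mv \<Theta> \<sigma>) (vec_mv d (basis l)))" for \<sigma> l
  \<comment> \<open>Summing over the finitely many \<sigma> makes the constant uniform; the summand
    1 keeps it positive.\<close>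
  define K where "K = 1 + (\<Sum>\<sigma>\<in>Pow {..<m}. \<Sum>l<d. N \<sigma> l)"
  have N_nonneg: "0 \<le> N \<sigma> l" for \<sigma> l
    by (simp add: N_def sup_norm_nonneg)
  have bound: "sup_norm d (wedge (L_mv \<Theta> \<sigma>) (vec_mv d z))
      \<le> K * (height s z * exp (s - real (1 - (m - card \<sigma>)) * (1 + \<kappa>) * s))"
    if s: "0 \<le> s" and \<sigma>: "\<sigma> \<subseteq> {..<m}" for s z \<sigma>
    unfolding sup_norm_le_iff
  proof (intro allI impI)
    fix J assume J: "J \<subseteq> {..<d}"
    let ?w = "\<lambda>l. wedge (L_mv \<Theta> \<sigma>) (vec_mv d (basis l)) J"
    let ?B = "height s z * exp (s - real (1 - (m - card \<sigma>)) * (1 + \<kappa>) * s)"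
    have B: "0 \<le> ?B"
      by (simp add: height_nonneg)
    have summand: "\<bar>coord z l * ?w l\<bar> \<le> ?B * N \<sigma> l" if l: "l < d" for l
    proof (cases "l \<in> \<sigma>")
      case True
      then show ?thesis
        using L_mv_absorb[OF \<sigma>] B N_nonneg by simp
    next
      case False
      have "real (1 - (m - card \<sigma>)) \<le> (if l < m then 0 else 1)"
      proof (cases "l < m")
        case True
        then have "\<sigma> \<subset> {..<m}"
          using \<sigma> False by auto
        then have "card \<sigma> < m"
          using psubset_card_mono[of "{..<m}" \<sigma>] by simp
        then show ?thesis
          using True by simp
      qed simp
      then have "real (1 - (m - card \<sigma>)) * ((1 + \<kappa>) * s) \<le> (if l < m then 0 else 1) * ((1 + \<kappa>) * s)"
        using s kappa_pos by (intro mult_right_mono) auto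
      then have "height s z * exp (s - (if l < m then 0 else 1) * (1 + \<kappa>) * s) \<le> ?B"
        by (intro mult_left_mono height_nonneg) (simp add: mult.assoc)
      then have "\<bar>coord z l\<bar> \<le> ?B"
        using abs_coord_le[OF l, of z s] by linarith
      moreover have "\<bar>?w l\<bar> \<le> N \<sigma> l"
        unfolding N_def by (rule abs_le_sup_norm[OF J])
      ultimately show ?thesis
        unfolding abs_mult by (intro mult_mono) auto
    qed
    have "wedge (L_mv \<Theta> \<sigma>) (vec_mv d z) J = (\<Sum>l<d. coord z l * ?w l)"
      by (subst vec_mv_expansion) (simp add: wedge_sum_right wedge_scale_right)
    also have "\<bar>\<dots>\<bar> \<le> (\<Sum>l<d. ?B * N \<sigma> l)"
      using summand by (intro order.trans[OF sum_abs] sum_mono) auto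
    also have "\<dots> = ?B * (\<Sum>l<d. N \<sigma> l)"
      by (simp add: sum_distrib_left)
    also have "\<dots> \<le> ?B * K"
    proof (intro mult_left_mono B)
      have "(\<Sum>l<d. N \<sigma> l) \<le> (\<Sum>\<sigma>\<in>Pow {..<m}. \<Sum>l<d. N \<sigma> l)"
        using \<sigma> N_nonneg by (intro member_le_sum) (auto intro: sum_nonneg)
      then show "(\<Sum>l<d. N \<sigma> l) \<le> K"
        by (simp add: K_def)
    qed
    finally show "\<bar>wedge (L_mv \<Theta> \<sigma>) (vec_mv d z) J\<bar> \<le> K * ?B"
      by (simp add: mult.commute)
  qed
  have "0 < K"
    unfolding K_def using N_nonneg by (intro add_pos_nonneg sum_nonneg) auto
  then show ?thesis
    using bound by (rule that)
qed

text \<open>Only pairs of distinct indices outside \<sigma> survive. At most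
  \<open>m - card \<sigma>\<close> of the two lie below \<open>m\<close>, so at least
  \<open>2 - (m - card \<sigma>)\<close> carry the small factor.\<close>

lemma wedge_two_bound:
  obtains K where "0 < K"
    "\<And>s z w \<sigma>. 0 \<le> s \<Longrightarrow> \<sigma> \<subseteq> {..<m} \<Longrightarrow> sup_norm d (wedge (L_mv \<Theta> \<sigma>) (wedge (vec_mv d z) (vec_mv d w)))
     \<le> K * (height s z * height s w * exp (2 * s - real (2 - (m - card \<sigma>)) * (1 + \<kappa>) * s))"
proof -
  define e where "e l = vec_mv d (basis l)" for l
  define N where "N \<sigma> p = sup_norm d (wedge (L_mv \<Theta> \<sigma>) (wedge (e (fst p)) (e (snd p))))" for \<sigma> p
  define K where "K = 1 + (\<Sum>\<sigma>\<in>Pow {..<m}. \<Sum>p\<in>{..<d} \<times> {..<d}. N \<sigma> p)"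
  have N_nonneg: "0 \<le> N \<sigma> p" for \<sigma> p
    by (simp add: N_def sup_norm_nonneg)
  have bound: "sup_norm d (wedge (L_mv \<Theta> \<sigma>) (wedge (vec_mv d z) (vec_mv d w)))
      \<le> K * (height s z * height s w * exp (2 * s - real (2 - (m - card \<sigma>)) * (1 + \<kappa>) * s))"
    if s: "0 \<le> s" and \<sigma>: "\<sigma> \<subseteq> {..<m}" for s z w \<sigma>
    unfolding sup_norm_le_iff
  proof (intro allI impI)
    fix J assume J: "J \<subseteq> {..<d}"
    let ?w = "\<lambda>k l. wedge (L_mv \<Theta> \<sigma>) (wedge (e k) (e l)) J"
    let ?B = "height s z * height s w * exp (2 * s - real (2 - (m - card \<sigma>)) * (1 + \<kappa>) * s)"
    have B: "0 \<le> ?B"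
      by (simp add: height_nonneg)
    have summand: "\<bar>coord z k * coord w l * ?w k l\<bar> \<le> ?B * N \<sigma> (k, l)" if kl: "k < d" "l < d" for k l
    proof (cases "k \<in> \<sigma> \<or> l \<in> \<sigma> \<or> k = l")
      case True
      have zero: "wedge (L_mv \<Theta> \<sigma>) (wedge (e k) v) = (\<lambda>_. 0)" if "k \<in> \<sigma>" for k v
        using L_mv_absorb[OF \<sigma> that] by (simp add: e_def wedge_assoc[symmetric] wedge_zero_left)
      have "?w k l = 0"
      proof (cases "k = l")
        case True
        then show ?thesis
          by (simp add: e_def vec_mv_wedge_self wedge_zero_right)
      next
        case False
        \<comment> \<open>If only \<open>l\<close> lies in \<sigma>, this brings it next to
          \<open>L_mv\<close>, where it is absorbed.\<close>
        have "?w k l = - ?w l k"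
          using wedge_scale_right[of "L_mv \<Theta> \<sigma>" "-1" "wedge (e l) (e k)"]
            vec_mv_anticommute[of d "basis k" "basis l"] by (simp add: e_def)
        then show ?thesis
          using True False zero[of k] zero[of l] by auto
      qed
      then show ?thesis
        using B N_nonneg by simp
    next
      case False
      define c :: real where "c = (if k < m then 0 else 1) + (if l < m then 0 else 1)"
      have "real (2 - (m - card \<sigma>)) \<le> c"
      proof -
        have "\<sigma> \<union> ({k, l} \<inter> {..<m}) \<subseteq> {..<m}"
          using \<sigma> by auto
        then have "card (\<sigma> \<union> ({k, l} \<inter> {..<m})) \<le> m"
          using card_mono[of "{..<m}"] by fastforce
        moreover have "card (\<sigma> \<union> ({k, l} \<inter> {..<m})) = card \<sigma> + card ({k, l} \<inter> {..<m})"
          using False \<sigma> finite_subset[OF \<sigma>] by (intro card_Un_disjoint) auto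
        moreover have "{k, l} \<inter> {..<m} = (if k < m then {k} else {}) \<union> (if l < m then {l} else {})"
          by auto
        ultimately show ?thesis
          using False by (auto simp: c_def split: if_splits)
      qed
      then have "real (2 - (m - card \<sigma>)) * ((1 + \<kappa>) * s) \<le> c * ((1 + \<kappa>) * s)"
        using s kappa_pos by (intro mult_right_mono) auto
      then have "height s z * height s w * exp (2 * s - c * (1 + \<kappa>) * s) \<le> ?B"
        by (intro mult_left_mono mult_nonneg_nonneg height_nonneg) (simp add: mult.assoc)
      moreover have "\<bar>coord z k * coord w l\<bar> \<le> height s z * height s w * exp (2 * s - c * (1 + \<kappa>) * s)"
      proof -
        have "\<bar>coord z k * coord w l\<bar> \<le> (height s z * exp (s - (if k < m then 0 else 1) * (1 + \<kappa>) * s))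
            * (height s w * exp (s - (if l < m then 0 else 1) * (1 + \<kappa>) * s))"
          unfolding abs_mult by (intro mult_mono abs_coord_le kl) (auto simp: height_nonneg)
        also have "\<dots> = height s z * height s w * exp (2 * s - c * (1 + \<kappa>) * s)"
          by (simp add: c_def mult_exp_exp[symmetric] exp_add[symmetric] algebra_simps)
        finally show ?thesis .
      qed
      ultimately have "\<bar>coord z k * coord w l\<bar> \<le> ?B"
        by linarith
      moreover have "\<bar>?w k l\<bar> \<le> N \<sigma> (k, l)"
        unfolding N_def fst_conv snd_conv by (rule abs_le_sup_norm[OF J])
      ultimately show ?thesis
        unfolding abs_mult[of "coord z k * coord w l"] by (intro mult_mono) auto
    qed
    have "wedge (L_mv \<Theta> \<sigma>) (wedge (e k) (vec_mv d w)) J = (\<Sum>l<d. coord w l * ?w k l)" for k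
      by (subst vec_mv_expansion) (simp only: wedge_sum_right wedge_scale_right e_def)
    moreover have "wedge (L_mv \<Theta> \<sigma>) (wedge (vec_mv d z) (vec_mv d w)) J
        = (\<Sum>k<d. coord z k * wedge (L_mv \<Theta> \<sigma>) (wedge (e k) (vec_mv d w)) J)"
      by (subst vec_mv_expansion[of z])
        (simp only: wedge_sum_left wedge_scale_left wedge_sum_right wedge_scale_right e_def)
    ultimately have "wedge (L_mv \<Theta> \<sigma>) (wedge (vec_mv d z) (vec_mv d w)) J
        = (\<Sum>k<d. \<Sum>l<d. coord z k * coord w l * ?w k l)"
      by (simp add: sum_distrib_left mult.assoc)
    then have eq: "wedge (L_mv \<Theta> \<sigma>) (wedge (vec_mv d z) (vec_mv d w)) J
        = (\<Sum>(k, l)\<in>{..<d} \<times> {..<d}. coord z k * coord w l * ?w k l)"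
      by (simp only: sum.cartesian_product)
    have "\<bar>wedge (L_mv \<Theta> \<sigma>) (wedge (vec_mv d z) (vec_mv d w)) J\<bar>
        \<le> (\<Sum>p\<in>{..<d} \<times> {..<d}. ?B * N \<sigma> p)"
      unfolding eq
    proof (rule order.trans[OF sum_abs], rule sum_mono)
      fix p assume "p \<in> {..<d} \<times> {..<d}"
      then obtain k l where p: "p = (k, l)" and "k < d" "l < d"
        by blast
      then show "\<bar>case p of (k, l) \<Rightarrow> coord z k * coord w l * ?w k l\<bar> \<le> ?B * N \<sigma> p"
        unfolding p prod.case by (intro summand)
    qed
    also have "\<dots> = ?B * (\<Sum>p\<in>{..<d} \<times> {..<d}. N \<sigma> p)"
      by (rule sum_distrib_left[symmetric])
    also have "\<dots> \<le> ?B * K"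
    proof (intro mult_left_mono B)
      have "(\<Sum>p\<in>{..<d} \<times> {..<d}. N \<sigma> p) \<le> (\<Sum>\<sigma>\<in>Pow {..<m}. \<Sum>p\<in>{..<d} \<times> {..<d}. N \<sigma> p)"
      proof (rule member_le_sum)
        show "0 \<le> (\<Sum>p\<in>{..<d} \<times> {..<d}. N \<tau> p)" for \<tau>
          by (intro sum_nonneg N_nonneg)
      qed (use \<sigma> in auto)
      then show "(\<Sum>p\<in>{..<d} \<times> {..<d}. N \<sigma> p) \<le> K"
        by (simp add: K_def)
    qed
    finally show "\<bar>wedge (L_mv \<Theta> \<sigma>) (wedge (vec_mv d z) (vec_mv d w)) J\<bar> \<le> K * ?B"
      by (simp add: mult.commute)
  qed
  have "0 < K"
    unfolding K_def using N_nonneg by (intro add_pos_nonneg sum_nonneg) auto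
  then show ?thesis
    using bound by (rule that)
qed

text \<open>Levels m - 1 and m are decoded. Up to sign, the coordinate \<open>{..<m}\<close> of the
  product with all columns but one is an entry of x, and the coordinate
  \<open>insert l {..<m}\<close> of the product with all columns is an entry of y - \<Theta>
  x.\<close>

lemma admissible_imp_lattice_point:
  assumes "uniform_admissible 1 \<Theta> \<gamma>"
  shows "\<forall>\<^sub>F t in at_top. \<exists>z\<in>lattice. (\<exists>i. z i \<noteq> 0) \<and> (\<forall>l<m. \<bar>coord z l\<bar> \<le> t) \<and>
    (\<forall>l. m \<le> l \<and> l < d \<longrightarrow> \<bar>coord z l\<bar> \<le> t powr (- \<gamma>))"
proof -
  have dim: "dim_row \<Theta> = n" "dim_col \<Theta> = m"
    using Theta_carrier by auto
  have "\<forall>\<^sub>F t :: real in at_top. \<exists>Z \<in> ext_lattice d 1. Z \<noteq> (\<lambda>_. 0) \<and>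
        (\<forall>k\<le>m. (MAX \<sigma>\<in>index_sets m k. sup_norm d (wedge (L_mv \<Theta> \<sigma>) Z))
                  \<le> t powr (1 - (real k - (real m - 1)) * (1 + \<gamma>)))"
    using assms m_pos by (simp add: uniform_admissible_def dim Let_def max_def)
  then show ?thesis
    using eventually_gt_at_top[of 0]
  proof eventually_elim
    case (elim t)
    then obtain Z where Z: "Z \<in> ext_lattice d 1" "Z \<noteq> (\<lambda>_. 0)"
      and bound: "\<And>k. k \<le> m \<Longrightarrow> (MAX \<sigma>\<in>index_sets m k. sup_norm d (wedge (L_mv \<Theta> \<sigma>) Z))
                  \<le> t powr (1 - (real k - (real m - 1)) * (1 + \<gamma>))"
      by blast
    define z where "z i = (if i < d then Z {i} else 0)" for i
    have supp: "J \<subseteq> {..<d} \<and> card J = 1" if "Z J \<noteq> 0" for J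
      using Z(1) that by (auto simp: ext_lattice_def ext_power_def)
    have Zz: "Z = vec_mv d z"
    proof
      fix J
      show "Z J = vec_mv d z J"
      proof (cases "\<exists>i<d. J = {i}")
        case False
        then have "vec_mv d z J = 0" "Z J = 0"
          using vec_mv_nonzeroD supp by (blast, metis card_1_singletonE insert_subset lessThan_iff)
        then show ?thesis
          by simp
      qed (auto simp: vec_mv_singleton z_def)
    qed
    have "z \<in> lattice"
      using Z(1) by (auto simp: lattice_def z_def ext_lattice_def)
    moreover have "\<exists>i. z i \<noteq> 0"
    proof (rule ccontr)
      assume "\<nexists>i. z i \<noteq> 0"
      then have "vec_mv d z J = 0" for J
        using vec_mv_nonzeroD[of d z J] by (cases "vec_mv d z J = 0") (auto simp: vec_mv_singleton)
      then show False
        using Z(2) Zz by auto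
    qed
    moreover have level: "\<bar>wedge (L_mv \<Theta> \<sigma>) Z J\<bar> \<le> t powr (1 - (real (card \<sigma>) - (real m - 1)) * (1 + \<gamma>))"
      if \<sigma>: "\<sigma> \<subseteq> {..<m}" and J: "J \<subseteq> {..<d}" for \<sigma> J
    proof -
      have card: "card \<sigma> \<le> m"
        using card_mono[of "{..<m}" \<sigma>] \<sigma> by simp
      have "finite (index_sets m (card \<sigma>))"
        by (rule finite_subset[of _ "Pow {..<m}"]) (auto simp: index_sets_def)
      then have "sup_norm d (wedge (L_mv \<Theta> \<sigma>) Z) \<le> (MAX \<sigma>\<in>index_sets m (card \<sigma>). sup_norm d (wedge (L_mv \<Theta> \<sigma>) Z))"
        using \<sigma> by (intro Max_ge) (auto simp: index_sets_def)
      then show ?thesis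
        using abs_le_sup_norm[OF J, of "wedge (L_mv \<Theta> \<sigma>) Z"] bound[OF card] by linarith
    qed
    moreover have "\<bar>coord z l\<bar> \<le> t" if l: "l < m" for l
    proof -
      let ?\<sigma> = "{..<m} - {l}"
      have "wedge (L_mv \<Theta> ?\<sigma>) Z {..<m}
          = (\<Sum>i<m. wedge_sign ({..<m} - {i}) {i} * L_mv \<Theta> ?\<sigma> ({..<m} - {i}) * z i)"
        unfolding Zz by (rule wedge_vec_mv_expand) auto
      also have "\<dots> = (\<Sum>i<m. if i = l then wedge_sign ?\<sigma> {l} * z l else 0)"
      proof (rule sum.cong)
        fix i assume "i \<in> {..<m}"
        then have "{..<m} - {i} = ?\<sigma> \<longleftrightarrow> i = l"
          using l by blast
        then show "wedge_sign ({..<m} - {i}) {i} * L_mv \<Theta> ?\<sigma> ({..<m} - {i}) * z i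
            = (if i = l then wedge_sign ?\<sigma> {l} * z l else 0)"
          by (subst L_mv_leading) auto
      qed simp
      also have "\<dots> = wedge_sign ?\<sigma> {l} * z l"
        using l by simp
      finally have "\<bar>z l\<bar> = \<bar>wedge (L_mv \<Theta> ?\<sigma>) Z {..<m}\<bar>"
        by (simp add: abs_mult)
      also have "\<dots> \<le> t powr (1 - (real (card ?\<sigma>) - (real m - 1)) * (1 + \<gamma>))"
        by (rule level) auto
      also have "real (card ?\<sigma>) = real m - 1"
        using l m_pos by (simp add: of_nat_diff)
      finally show ?thesis
        using l \<open>0 < t\<close> by (simp add: coord_def)
    qed
    moreover have "\<bar>coord z l\<bar> \<le> t powr (- \<gamma>)" if l: "m \<le> l" "l < d" for l
    proof -
      let ?J = "insert l {..<m}"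
      have J: "?J \<subseteq> {..<d}"
        using l by auto
      have D: "?J - {l} = {..<m}"
        using l by auto
      have val: "wedge (L_mv \<Theta> {..<m}) (vec_mv d (basis k)) ?J = (if k = l then wedge_sign {..<m} {l} else 0)"
        if k: "m \<le> k" for k
      proof -
        have "wedge (L_mv \<Theta> {..<m}) (vec_mv d (basis k)) ?J
            = (\<Sum>i\<in>?J. wedge_sign (?J - {i}) {i} * L_mv \<Theta> {..<m} (?J - {i}) * basis k i)"
          by (rule wedge_vec_mv_expand[OF J])
        also have "\<dots> = (\<Sum>i\<in>?J. if i = l then (if k = l then wedge_sign {..<m} {l} else 0) else 0)"
          using k l by (intro sum.cong) (auto simp: basis_def D L_mv_leading)
        finally show ?thesis
          by simp
      qed
      have "wedge (L_mv \<Theta> {..<m}) Z ?J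
          = (\<Sum>k<d. coord z k * wedge (L_mv \<Theta> {..<m}) (vec_mv d (basis k)) ?J)"
        unfolding Zz by (subst vec_mv_expansion) (simp add: wedge_sum_right wedge_scale_right)
      also have "\<dots> = (\<Sum>k<d. if k = l then coord z l * wedge_sign {..<m} {l} else 0)"
      proof (rule sum.cong)
        fix k
        show "coord z k * wedge (L_mv \<Theta> {..<m}) (vec_mv d (basis k)) ?J
            = (if k = l then coord z l * wedge_sign {..<m} {l} else 0)"
          using val[of k] L_mv_absorb[of "{..<m}" k] l by (cases "k < m") auto
      qed simp
      also have "\<dots> = coord z l * wedge_sign {..<m} {l}"
        using l by simp
      finally have "\<bar>coord z l\<bar> = \<bar>wedge (L_mv \<Theta> {..<m}) Z ?J\<bar>"
        by (simp add: abs_mult)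
      also have "\<dots> \<le> t powr (1 - (real (card {..<m}) - (real m - 1)) * (1 + \<gamma>))"
        by (rule level) (use J in auto)
      finally show ?thesis
        by simp
    qed
    ultimately show ?case
      by blast
  qed
qed

end

section \<open>Geometry of numbers\<close>

lemma card_int_set_le:
  fixes K :: "int set" and R :: real
  assumes "finite K" "0 \<le> R" and "\<And>x y. x \<in> K \<Longrightarrow> y \<in> K \<Longrightarrow> real_of_int (x - y) \<le> R"
  shows "real (card K) \<le> 1 + R"
proof (cases "K = {}")
  case False
  have "K \<subseteq> {Min K..Max K}"
    using assms(1) by auto
  then have "card K \<le> card {Min K..Max K}"
    by (intro card_mono) auto
  moreover have "Min K \<le> Max K"
    using assms(1) False by (simp add: Min_le_iff)
  ultimately have "real (card K) \<le> 1 + real_of_int (Max K - Min K)"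
    by simp
  also have "\<dots> \<le> 1 + R"
    using assms(1,3) False by simp
  finally show ?thesis .
qed (use assms in simp)

text \<open>Stated by minors, so that the zero vector is parallel to everything and a point not
  parallel to \<open>z\<close> is automatically nonzero.\<close>

definition parallel :: "(nat \<Rightarrow> real) \<Rightarrow> (nat \<Rightarrow> real) \<Rightarrow> bool" where
  "parallel z w \<longleftrightarrow> (\<forall>i j. z i * w j = z j * w i)"

context theta_matrix
begin

lemma coord_diff_scale: "coord (\<lambda>i. z i - q * w i) l = coord z l - q * coord w l"
  by (simp add: coord_def sum_subtractf sum_distrib_left algebra_simps)

lemma coord_scale: "coord (\<lambda>i. q * w i) l = q * coord w l"
  by (simp add: coord_def sum_distrib_left algebra_simps)

lemma lattice_diff_scale:
  assumes "z \<in> lattice" "w \<in> lattice"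
  shows "(\<lambda>i. z i - of_int k * w i) \<in> lattice"
  using assms by (auto simp: lattice_def intro!: Ints_diff Ints_mult)

lemma height_le_iff: "height s z \<le> B \<longleftrightarrow> (\<forall>l<d. \<bar>coord z l\<bar> * wt s l \<le> B)"
  using height_attained[of s z] height_ge[of _ z s] by force

lemma height_less_iff: "height s z < B \<longleftrightarrow> (\<forall>l<d. \<bar>coord z l\<bar> * wt s l < B)"
  using height_attained[of s z] height_ge[of _ z s] by force

lemma height_scale: "height s (\<lambda>i. q * z i) = \<bar>q\<bar> * height s z"
proof (rule antisym)
  show "height s (\<lambda>i. q * z i) \<le> \<bar>q\<bar> * height s z"
    unfolding height_le_iff
    by (auto simp: coord_scale abs_mult mult.assoc intro!: mult_left_mono height_ge)
  obtain l where l: "l < d" "height s z = \<bar>coord z l\<bar> * wt s l"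
    using height_attained by blast
  show "\<bar>q\<bar> * height s z \<le> height s (\<lambda>i. q * z i)"
    using height_ge[OF l(1), of "\<lambda>i. q * z i" s] by (simp add: l(2) coord_scale abs_mult mult.assoc)
qed

lemma height_pos:
  assumes "z \<in> lattice" "\<exists>i. z i \<noteq> 0"
  shows "0 < height s z"
proof (rule ccontr)
  assume "\<not> 0 < height s z"
  then have "height s z \<le> 0"
    by simp
  then have "\<bar>coord z l\<bar> * wt s l \<le> 0" if "l < d" for l
    using that by (simp add: height_le_iff)
  then have "coord z l = 0" if "l < d" for l
    using that wt_pos[of s l] by (fastforce simp: mult_le_0_iff)
  then have "z i = 0" for i
    using coord_expansion[of i z] assms(1) by (cases "i < d") (auto simp: lattice_def)
  then show False
    using assms(2) by simp
qed

text \<open>Discreteness: the basis expansion bounds all integer entries. The double sum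
  \<open>M\<close> is crude but uniform in \<open>i\<close>.\<close>

lemma finite_height_le: "finite {z \<in> lattice. height s z \<le> B}"
proof -
  define M where "M = (\<Sum>i<d. \<Sum>l<d. \<bar>B\<bar> * inverse (wt s l) * \<bar>basis l i\<bar>)"
  have "{z \<in> lattice. height s z \<le> B}
      \<subseteq> {z. \<forall>i. (i \<in> {..<d} \<longrightarrow> z i \<in> {k \<in> \<int>. \<bar>k\<bar> \<le> M}) \<and> (i \<notin> {..<d} \<longrightarrow> z i = 0)}"
  proof clarify
    fix z i assume z: "z \<in> lattice" "height s z \<le> B"
    have nonneg: "0 \<le> \<bar>B\<bar> * inverse (wt s l) * \<bar>basis l i\<bar>" for l i
      using wt_pos[of s l] by (intro mult_nonneg_nonneg) (auto simp: less_imp_le)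
    have "\<bar>z i\<bar> \<le> M" if i: "i < d"
    proof -
      have "\<bar>z i\<bar> \<le> (\<Sum>l<d. \<bar>coord z l * basis l i\<bar>)"
        unfolding coord_expansion[OF i, of z] by (rule sum_abs)
      also have "\<dots> \<le> (\<Sum>l<d. \<bar>B\<bar> * inverse (wt s l) * \<bar>basis l i\<bar>)"
      proof (rule sum_mono)
        fix l assume "l \<in> {..<d}"
        then have "\<bar>coord z l\<bar> * wt s l \<le> \<bar>B\<bar>"
          using z(2) height_ge[of l z s] by simp
        then have "\<bar>coord z l\<bar> \<le> \<bar>B\<bar> * inverse (wt s l)"
          using wt_pos[of s l] by (simp add: field_simps)
        then show "\<bar>coord z l * basis l i\<bar> \<le> \<bar>B\<bar> * inverse (wt s l) * \<bar>basis l i\<bar>"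
          unfolding abs_mult by (intro mult_right_mono) auto
      qed
      also have "\<dots> \<le> M"
        unfolding M_def
      proof (rule member_le_sum)
        show "0 \<le> (\<Sum>l<d. \<bar>B\<bar> * inverse (wt s l) * \<bar>basis l k\<bar>)" for k
          by (intro sum_nonneg nonneg)
      qed (use i in auto)
      finally show ?thesis .
    qed
    then show "(i \<in> {..<d} \<longrightarrow> z i \<in> {k \<in> \<int>. \<bar>k\<bar> \<le> M}) \<and> (i \<notin> {..<d} \<longrightarrow> z i = 0)"
      using z(1) by (auto simp: lattice_def)
  qed
  moreover have "finite {z :: nat \<Rightarrow> real. \<forall>i. (i \<in> {..<d} \<longrightarrow> z i \<in> {k \<in> \<int>. \<bar>k\<bar> \<le> M})
      \<and> (i \<notin> {..<d} \<longrightarrow> z i = 0)}"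
    by (intro finite_set_of_finite_funs finite_abs_int_segment) auto
  ultimately show ?thesis
    using finite_subset by blast
qed

lemma height_minimizer:
  assumes "S \<subseteq> lattice" "S \<noteq> {}"
  obtains z where "z \<in> S" "\<And>w. w \<in> S \<Longrightarrow> height s z \<le> height s w"
proof -
  obtain z\<^sub>0 where z0: "z\<^sub>0 \<in> S"
    using assms(2) by blast
  let ?T = "{w \<in> S. height s w \<le> height s z\<^sub>0}"
  have "finite ?T"
    by (rule finite_subset[OF _ finite_height_le]) (use assms(1) in blast)
  moreover have "?T \<noteq> {}"
    using z0 by auto
  ultimately have "Min (height s ` ?T) \<in> height s ` ?T" and min: "\<And>w. w \<in> ?T \<Longrightarrow> Min (height s ` ?T) \<le> height s w"
    by (auto intro: Min_in Min_le)
  then obtain z where "z \<in> ?T" "Min (height s ` ?T) = height s z"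
    by blast
  with min have z: "z \<in> ?T" "\<And>w. w \<in> ?T \<Longrightarrow> height s z \<le> height s w"
    by simp_all
  have "height s z \<le> height s w" if "w \<in> S" for w
    using z that by (cases "height s w \<le> height s z\<^sub>0") auto
  then show ?thesis
    using that z(1) by blast
qed

text \<open>A shortest vector is primitive: removing the integer part of the ratio leaves
  \<open>frac q\<close> times \<open>z\<close>, a lattice point shorter than \<open>z\<close>, which
  must vanish.\<close>

lemma parallel_multiple:
  assumes "z \<in> lattice" "\<exists>i. z i \<noteq> 0"
    and min: "\<And>w. w \<in> lattice \<Longrightarrow> \<exists>i. w i \<noteq> 0 \<Longrightarrow> height s z \<le> height s w"
    and w: "w \<in> lattice" "parallel z w"
  shows "\<exists>k::int. w = (\<lambda>i. of_int k * z i)"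
proof -
  obtain i\<^sub>0 where i0: "z i\<^sub>0 \<noteq> 0"
    using assms(2) by blast
  define q where "q = w i\<^sub>0 / z i\<^sub>0"
  have wq: "w j = q * z j" for j
    using w(2) i0 by (auto simp: parallel_def q_def field_simps)
  define u where "u i = w i - of_int \<lfloor>q\<rfloor> * z i" for i
  have u: "u = (\<lambda>i. frac q * z i)"
    by (rule ext) (simp add: u_def wq frac_def algebra_simps)
  have "u \<in> lattice"
    unfolding u_def by (rule lattice_diff_scale[OF w(1) assms(1)])
  moreover have "height s u < height s z"
    using height_pos[OF assms(1,2), of s] frac_lt_1[of q] by (simp add: u height_scale)
  ultimately have "u i = 0" for i
    using min[of u] by force
  then have "w = (\<lambda>i. of_int \<lfloor>q\<rfloor> * z i)"
    by (intro ext) (simp add: u_def)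
  then show ?thesis
    by blast
qed

lemma minus_le_kappa: "0 \<le> s \<Longrightarrow> - s \<le> \<kappa> * s"
  using mult_nonneg_nonneg[of \<kappa> s] kappa_pos by linarith

lemma wt_le: "0 \<le> s \<Longrightarrow> wt s l \<le> exp (\<kappa> * s)"
  using minus_le_kappa[of s] by (auto simp: wt_def)

text \<open>A nonzero entry of x contributes at least \<open>exp (- s)\<close>. If x = 0, some entry
  of y is a nonzero integer and contributes even \<open>exp (\<kappa> * s)\<close>.\<close>

lemma height_ge_exp:
  assumes z: "z \<in> lattice" "\<exists>i. z i \<noteq> 0" and "0 \<le> s"
  shows "exp (- s) \<le> height s z"
proof -
  have int: "1 \<le> \<bar>z i\<bar>" if "z i \<noteq> 0" for i
    using z(1) that Ints_nonzero_abs_ge1[of "z i"] by (simp add: lattice_def)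
  show ?thesis
  proof (cases "\<exists>i<m. z i \<noteq> 0")
    case True
    then obtain i where i: "i < m" "z i \<noteq> 0"
      by blast
    have "1 * exp (- s) \<le> \<bar>coord z i\<bar> * wt s i"
      using i int[of i] by (simp add: coord_def wt_def)
    then show ?thesis
      using height_ge[of i z s] i by simp
  next
    case False
    obtain i where "z i \<noteq> 0"
      using z(2) by blast
    moreover from this have "i < d"
      using z(1) by (fastforce simp: lattice_def not_less[symmetric])
    ultimately have i: "m \<le> i" "i < d" "z i \<noteq> 0"
      using False by (auto simp: not_less[symmetric])
    have "coord z i = z i"
      using False i by (simp add: coord_def)
    then have "1 * wt s i \<le> \<bar>coord z i\<bar> * wt s i"
      using int[of i] i wt_pos[of s i] by (intro mult_right_mono) auto
    moreover have "exp (- s) \<le> wt s i"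
      using i minus_le_kappa[OF \<open>0 \<le> s\<close>] by (simp add: wt_def)
    ultimately show ?thesis
      using height_ge[of i z s] i by simp
  qed
qed

text \<open>The lattice point above x for which y - \<Theta> x consists of negated fractional parts,
  the quantities that the pigeonhole argument sorts.\<close>

definition round_point :: "(nat \<Rightarrow> int) \<Rightarrow> nat \<Rightarrow> real" where
  "round_point x i = (if i < m then of_int (x i)
     else if i < d then of_int \<lfloor>\<Sum>k<m. \<Theta> $$ (i - m, k) * of_int (x k)\<rfloor> else 0)"

lemma round_point_lattice: "round_point x \<in> lattice"
  by (auto simp: lattice_def round_point_def)

lemma coord_round_point:
  "coord (round_point x) l = (if l < m then of_int (x l) else
     if l < d then - frac (\<Sum>k<m. \<Theta> $$ (l - m, k) * of_int (x k))
     else - (\<Sum>k<m. \<Theta> $$ (l - m, k) * of_int (x k)))"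
  by (auto simp: coord_def round_point_def frac_def)

text \<open>A point with x = 0, whose height is known exactly at every time. It serves at negative
  times and on bounded ranges of times.\<close>

definition last_unit :: "nat \<Rightarrow> real" where
  "last_unit i = (if i = d - 1 then 1 else 0)"

lemma last_unit_lattice: "last_unit \<in> lattice"
  using m_pos by (auto simp: lattice_def last_unit_def)

lemma height_last_unit: "height s last_unit = exp (\<kappa> * s)"
proof -
  have "coord last_unit l = (if l = d - 1 then 1 else 0)" if "l < d" for l
    using that n_pos by (auto simp: coord_def last_unit_def intro!: sum.neutral)
  moreover have "wt s (d - 1) = exp (\<kappa> * s)"
    using n_pos by (auto simp: wt_def)
  ultimately show ?thesis
    using height_le_iff[of s last_unit "exp (\<kappa> * s)"] height_ge[of "d - 1" last_unit s] m_pos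
    by (intro antisym) auto
qed

text \<open>At most one of the two explicit points \<open>last_unit\<close> and \<open>?g\<close> is
  parallel to \<open>z\<close>. The height bound supplies
  \<open>\<mu> \<le> exp (\<kappa> * s)\<close> in the pigeonhole argument.\<close>

lemma nonparallel_exists:
  assumes z: "z \<in> lattice" "\<exists>i. z i \<noteq> 0" and s: "0 \<le> s"
  shows "\<exists>w\<in>lattice. \<not> parallel z w \<and> height s w \<le> exp (\<kappa> * s)"
proof -
  let ?g = "round_point (\<lambda>i. if i = 0 then 1 else 0)"
  have "\<bar>coord ?g l\<bar> \<le> 1" if "l < d" for l
    using that by (auto simp: coord_round_point intro: less_imp_le[OF frac_lt_1])
  then have "\<bar>coord ?g l\<bar> * wt s l \<le> 1 * exp (\<kappa> * s)" if "l < d" for l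
    using that wt_pos[of s l] wt_le[OF s] by (intro mult_mono) (auto simp: less_imp_le)
  then have g: "height s ?g \<le> exp (\<kappa> * s)"
    by (simp add: height_le_iff)
  show ?thesis
  proof (cases "parallel z last_unit")
    case True
    have 0: "z j = 0" if "j \<noteq> d - 1" for j
      using True[unfolded parallel_def, rule_format, of j "d - 1"] that by (simp add: last_unit_def)
    obtain i where "z i \<noteq> 0"
      using z(2) by blast
    then have "z (d - 1) \<noteq> 0"
      using 0[of i] by metis
    moreover have "z 0 = 0" "?g 0 = 1"
      using 0 m_pos n_pos by (auto simp: round_point_def)
    ultimately have "z (d - 1) * ?g 0 \<noteq> z 0 * ?g (d - 1)"
      by simp
    then have "\<not> parallel z ?g"
      unfolding parallel_def by blast
    then show ?thesis
      using g round_point_lattice by blast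
  next
    case False
    then show ?thesis
      using last_unit_lattice height_last_unit by auto
  qed
qed

text \<open>No weight falls faster than those of the contracted coordinates; backward in time the
  other coordinates set the rate.\<close>

lemma height_shift_forward: "0 \<le> \<delta> \<Longrightarrow> exp (- \<delta>) * height s w \<le> height (s + \<delta>) w"
proof -
  assume \<delta>: "0 \<le> \<delta>"
  obtain l where l: "l < d" "height s w = \<bar>coord w l\<bar> * wt s l"
    using height_attained by blast
  have "- \<delta> \<le> \<kappa> * \<delta>"
    using \<delta> by (rule minus_le_kappa)
  then have "exp (- \<delta>) * wt s l \<le> wt (s + \<delta>) l"
    by (auto simp: wt_def exp_add[symmetric] algebra_simps)
  then have "\<bar>coord w l\<bar> * (exp (- \<delta>) * wt s l) \<le> \<bar>coord w l\<bar> * wt (s + \<delta>) l"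
    by (intro mult_left_mono) auto
  also have "\<dots> \<le> height (s + \<delta>) w"
    by (rule height_ge[OF l(1)])
  finally show ?thesis
    by (simp add: l(2) mult_ac)
qed

lemma height_shift_backward: "0 \<le> \<delta> \<Longrightarrow> exp (- \<kappa> * \<delta>) * height s w \<le> height (s - \<delta>) w"
proof -
  assume \<delta>: "0 \<le> \<delta>"
  obtain l where l: "l < d" "height s w = \<bar>coord w l\<bar> * wt s l"
    using height_attained by blast
  have "- \<delta> \<le> \<kappa> * \<delta>"
    using \<delta> by (rule minus_le_kappa)
  then have "exp (- \<kappa> * \<delta>) * wt s l \<le> wt (s - \<delta>) l"
    by (auto simp: wt_def exp_add[symmetric] algebra_simps)
  then have "\<bar>coord w l\<bar> * (exp (- \<kappa> * \<delta>) * wt s l) \<le> \<bar>coord w l\<bar> * wt (s - \<delta>) l"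
    by (intro mult_left_mono) auto
  also have "\<dots> \<le> height (s - \<delta>) w"
    by (rule height_ge[OF l(1)])
  finally show ?thesis
    by (simp add: l(2) mult_ac)
qed

text \<open>
  Pigeonhole on the integer points \<open>x\<close> of a box of side \<open>\<mu> exp s\<close>, sorted by the fractional parts
  of \<open>\<Theta> x\<close> into cells of side less than \<open>\<mu> exp (- \<kappa> s)\<close>: two points in one cell differ by an
  integer multiple of \<open>z\<close>, so a cell holds at most \<open>1 + \<mu> / height s z\<close> points.
\<close>

lemma first_minima_product_le:
  assumes z: "z \<in> lattice" "\<exists>i. z i \<noteq> 0"
    and zmin: "\<And>u. u \<in> lattice \<Longrightarrow> \<exists>i. u i \<noteq> 0 \<Longrightarrow> height s z \<le> height s u"
    and s: "0 \<le> s" and \<mu>: "exp (- s) \<le> \<mu>" "\<mu> \<le> exp (\<kappa> * s)" "height s z \<le> \<mu>"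
    and wmin: "\<And>u. u \<in> lattice \<Longrightarrow> \<not> parallel z u \<Longrightarrow> \<mu> \<le> height s u"
  shows "height s z * \<mu> ^ (d - 1) \<le> 2 ^ (n + 1)"
proof -
  define A where "A = nat \<lceil>\<mu> * exp s\<rceil>"
  \<comment> \<open>\<open>B\<close> is the least number of cells per axis with side below
    \<open>\<mu> * exp (- \<kappa> * s)\<close>; since the quotient is at least 1, rounding at most
    doubles it.\<close>
  define B where "B = nat \<lfloor>exp (\<kappa> * s) / \<mu>\<rfloor> + 1"
  have \<mu>_pos: "0 < \<mu>"
    using \<mu>(1) exp_gt_zero[of "- s"] by linarith
  have A: "\<mu> * exp s \<le> real A" "real A - 1 < \<mu> * exp s"
    using \<mu>_pos by (auto simp: A_def) linarith+
  have quot: "1 \<le> exp (\<kappa> * s) / \<mu>"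
    using \<mu>_pos \<mu>(2) by simp
  have B: "exp (\<kappa> * s) / \<mu> < real B" "real B \<le> 2 * (exp (\<kappa> * s) / \<mu>)"
    using quot by (auto simp: B_def) linarith+
  have B_pos: "0 < real B"
    by (simp add: B_def)
  define \<phi> where "\<phi> x j = frac (\<Sum>k<m. \<Theta> $$ (j, k) * of_int (x k))" for x :: "nat \<Rightarrow> int" and j
  define X where "X = PiE {..<m} (\<lambda>_. {0..<int A})"
  define cell where "cell x = (\<lambda>j\<in>{..<n}. \<lfloor>real B * \<phi> x j\<rfloor>)" for x
  define Y where "Y = PiE {..<n} (\<lambda>_. {0..<int B})"
  have \<phi>: "0 \<le> \<phi> x j" "\<phi> x j < 1" for x j
    by (auto simp: \<phi>_def frac_lt_1)
  have "cell \<in> X \<rightarrow> Y"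
  proof
    fix x assume "x \<in> X"
    have "0 \<le> \<lfloor>real B * \<phi> x j\<rfloor>" "\<lfloor>real B * \<phi> x j\<rfloor> < int B" for j
      using \<phi>[of x j] B_pos by (auto simp: floor_less_iff)
    then show "cell x \<in> Y"
      by (auto simp: cell_def Y_def)
  qed
  moreover have "finite X" "finite Y" "card X = A ^ m" "card Y = B ^ n"
    by (auto simp: X_def Y_def card_PiE intro!: finite_PiE)
  moreover have "Y \<noteq> {}"
    using B_pos by (auto simp: Y_def PiE_eq_empty_iff)
  ultimately obtain c where c: "A ^ m \<le> card (cell -` {c} \<inter> X) * B ^ n"
    using pigeonhole_card[of cell X Y] by metis
  define S where "S = cell -` {c} \<inter> X"
  have finS: "finite S"
    using \<open>finite X\<close> by (simp add: S_def)
  \<comment> \<open>Strictly below \<mu>, so that \<open>wmin\<close> forces the difference to be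
    parallel to \<open>z\<close>.\<close>
  have close: "height s (\<lambda>i. round_point x i - 1 * round_point y i) < \<mu>" if "x \<in> S" "y \<in> S" for x y
    unfolding height_less_iff coord_diff_scale
  proof (intro allI impI)
    fix l assume l: "l < d"
    show "\<bar>coord (round_point x) l - 1 * coord (round_point y) l\<bar> * wt s l < \<mu>"
    proof (cases "l < m")
      case True
      then have "l \<in> {..<m}"
        by simp
      moreover have "x \<in> PiE {..<m} (\<lambda>_. {0..<int A})" "y \<in> PiE {..<m} (\<lambda>_. {0..<int A})"
        using that by (simp_all add: S_def X_def)
      ultimately have "x l \<in> {0..<int A}" "y l \<in> {0..<int A}"
        by (metis PiE_mem)+
      then have "\<bar>x l - y l\<bar> \<le> int A - 1"
        unfolding atLeastLessThan_iff by linarith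
      then have "real_of_int \<bar>x l - y l\<bar> \<le> real_of_int (int A - 1)"
        by (simp only: of_int_le_iff)
      then have "\<bar>real_of_int (x l - y l)\<bar> \<le> real A - 1"
        by (simp only: of_int_abs of_int_diff of_int_of_nat_eq of_int_1)
      then have "\<bar>real_of_int (x l - y l)\<bar> < \<mu> * exp s"
        using A(2) by linarith
      then have "\<bar>real_of_int (x l - y l)\<bar> * exp (- s) < \<mu> * exp s * exp (- s)"
        by (intro mult_strict_right_mono) auto
      also have "\<mu> * exp s * exp (- s) = \<mu>"
        by (simp add: exp_minus)
      finally show ?thesis
        using True by (simp add: coord_round_point wt_def)
    next
      case False
      then have j: "l - m < n"
        using l by linarith
      have "cell x (l - m) = cell y (l - m)"
        using that by (simp add: S_def)
      then have "\<lfloor>real B * \<phi> x (l - m)\<rfloor> = \<lfloor>real B * \<phi> y (l - m)\<rfloor>"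
        using j by (simp add: cell_def)
      then have "\<bar>real B * \<phi> x (l - m) - real B * \<phi> y (l - m)\<bar> < 1"
        by linarith
      then have "real B * \<bar>\<phi> x (l - m) - \<phi> y (l - m)\<bar> < 1"
        using B_pos by (simp add: abs_mult right_diff_distrib[symmetric])
      then have "\<bar>\<phi> x (l - m) - \<phi> y (l - m)\<bar> < 1 / real B"
        using B_pos by (simp add: field_simps)
      also have "\<dots> < \<mu> / exp (\<kappa> * s)"
        using B(1) B_pos \<mu>_pos by (simp add: field_simps)
      finally have "\<bar>\<phi> x (l - m) - \<phi> y (l - m)\<bar> * exp (\<kappa> * s) < \<mu>"
        by (simp only: pos_less_divide_eq exp_gt_zero)
      moreover have "\<bar>coord (round_point x) l - 1 * coord (round_point y) l\<bar> = \<bar>\<phi> x (l - m) - \<phi> y (l - m)\<bar>"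
        using False l by (simp add: coord_round_point \<phi>_def)
      ultimately show ?thesis
        using False by (simp only: wt_def if_False)
    qed
  qed
  have "real (card S) \<le> 1 + \<mu> / height s z"
  proof (cases "S = {}")
    case True
    then show ?thesis
      using \<mu>_pos height_nonneg[of s z] by simp
  next
    case False
    then obtain x\<^sub>0 where x0: "x\<^sub>0 \<in> S"
      by blast
    have "\<exists>k::int. (\<lambda>i. round_point x i - 1 * round_point x\<^sub>0 i) = (\<lambda>i. of_int k * z i)" if "x \<in> S" for x
    proof -
      have lat: "(\<lambda>i. round_point x i - 1 * round_point x\<^sub>0 i) \<in> lattice"
        using lattice_diff_scale[OF round_point_lattice round_point_lattice, of x 1 x\<^sub>0] by simp
      then have "parallel z (\<lambda>i. round_point x i - 1 * round_point x\<^sub>0 i)"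
        using close[OF that x0] wmin by force
      then show ?thesis
        by (intro parallel_multiple[OF z zmin lat])
    qed
    then obtain k :: "(nat \<Rightarrow> int) \<Rightarrow> int" where
      k: "\<And>x. x \<in> S \<Longrightarrow> (\<lambda>i. round_point x i - 1 * round_point x\<^sub>0 i) = (\<lambda>i. of_int (k x) * z i)"
      by metis
    then have k': "round_point x i - round_point x\<^sub>0 i = of_int (k x) * z i" if "x \<in> S" for x i
      using fun_cong[OF k[OF that], of i] by simp
    \<comment> \<open>Equal multipliers give equal rounded points, which determine \<open>x\<close>
      on \<open>{..<m}\<close>; elsewhere the box consists of extensional functions.\<close>
    have "inj_on k S"
    proof
      fix x y assume xy: "x \<in> S" "y \<in> S" "k x = k y"
      then have eq: "round_point x i = round_point y i" for i
        using k'[of x i] k'[of y i] by simp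
      have "x i = y i" if "i < m" for i
        using eq[of i] that by (simp add: round_point_def)
      moreover have "x \<in> extensional {..<m}" "y \<in> extensional {..<m}"
        using xy by (auto simp: S_def X_def PiE_def)
      ultimately show "x = y"
        by (intro extensionalityI) auto
    qed
    then have "card S = card (k ` S)"
      by (simp add: card_image)
    also have "real \<dots> \<le> 1 + \<mu> / height s z"
    proof (rule card_int_set_le)
      fix a b assume "a \<in> k ` S" "b \<in> k ` S"
      then obtain x y where xy: "x \<in> S" "y \<in> S" "a = k x" "b = k y"
        by blast
      have "(\<lambda>i. round_point x i - 1 * round_point y i) = (\<lambda>i. of_int (k x - k y) * z i)"
        by (rule ext) (use k'[OF xy(1)] k'[OF xy(2)] in \<open>simp add: algebra_simps\<close>)
      then have "\<bar>real_of_int (k x - k y)\<bar> * height s z < \<mu>"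
        using close[OF xy(1,2)] height_scale[of s "real_of_int (k x - k y)" z] by simp
      then have "\<bar>real_of_int (k x - k y)\<bar> < \<mu> / height s z"
        using height_pos[OF z, of s] by (simp add: field_simps)
      then show "real_of_int (a - b) \<le> \<mu> / height s z"
        using xy by linarith
    qed (use finS \<mu>_pos height_nonneg[of s z] in auto)
    finally show ?thesis .
  qed
  \<comment> \<open>One factor of \<open>2 ^ (n + 1)\<close> absorbs the summand 1 here; the other
    \<open>n\<close> come from \<open>B(2)\<close>.\<close>
  also have "\<dots> \<le> 2 * \<mu> / height s z"
    using \<mu>(3) height_pos[OF z, of s] by (simp add: field_simps)
  finally have card: "real (card S) \<le> 2 * \<mu> / height s z" .
  have le1: "\<mu> ^ m * exp s ^ m \<le> real A ^ m"
    unfolding power_mult_distrib[symmetric] using A(1) \<mu>_pos by (intro power_mono) auto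
  have le2: "real A ^ m \<le> real (card S) * real B ^ n"
  proof -
    have "real (A ^ m) \<le> real (card S * B ^ n)"
      using c by (simp only: S_def of_nat_le_iff)
    then show ?thesis
      by simp
  qed
  have le3: "real (card S) * real B ^ n \<le> (2 * \<mu> / height s z) * (2 * (exp (\<kappa> * s) / \<mu>)) ^ n"
  proof (rule mult_mono[OF card])
    show "real B ^ n \<le> (2 * (exp (\<kappa> * s) / \<mu>)) ^ n"
      using B(2) by (rule power_mono) simp
    show "0 \<le> 2 * \<mu> / height s z"
      using \<mu>_pos height_nonneg[of s z] by simp
  qed simp
  \<comment> \<open>The volume-preserving choice of \<kappa>: with it the time dependence cancels
    from both sides.\<close>
  have E: "exp (\<kappa> * s) ^ n = exp s ^ m"
    unfolding exp_of_nat_mult[symmetric] using n_pos by (simp add: \<kappa>_def)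
  have eq: "(2 * \<mu> / height s z) * (2 * (exp (\<kappa> * s) / \<mu>)) ^ n
      = 2 ^ (n + 1) * \<mu> / (height s z * \<mu> ^ n) * exp s ^ m"
    unfolding power_mult_distrib power_divide E
    by (simp only: power_add power_one_right times_divide_eq_left times_divide_eq_right
        divide_divide_eq_left mult_ac)
  have "\<mu> ^ m * exp s ^ m \<le> 2 ^ (n + 1) * \<mu> / (height s z * \<mu> ^ n) * exp s ^ m"
    by (rule order.trans[OF le1 order.trans[OF le2 le3[unfolded eq]]])
  then have "\<mu> ^ m \<le> 2 ^ (n + 1) * \<mu> / (height s z * \<mu> ^ n)"
    by (rule mult_right_le_imp_le) simp
  moreover have "0 < height s z * \<mu> ^ n"
    using \<mu>_pos height_pos[OF z, of s] by simp
  ultimately have "\<mu> ^ m * (height s z * \<mu> ^ n) \<le> 2 ^ (n + 1) * \<mu>"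
    by (simp only: pos_le_divide_eq)
  then have "height s z * \<mu> ^ d \<le> 2 ^ (n + 1) * \<mu>"
    by (simp only: power_add mult_ac)
  moreover have "\<mu> ^ d = \<mu> ^ (d - 1) * \<mu>"
    using m_pos by (intro power_minus_mult[symmetric]) simp
  ultimately have "height s z * \<mu> ^ (d - 1) * \<mu> \<le> 2 ^ (n + 1) * \<mu>"
    by (simp add: mult.assoc)
  then show ?thesis
    by (rule mult_right_le_imp_le) (rule \<mu>_pos)
qed

lemma two_minima:
  assumes s: "0 \<le> s"
  obtains z w where "z \<in> lattice" "\<exists>i. z i \<noteq> 0" "w \<in> lattice" "\<not> parallel z w"
    "\<And>u. u \<in> lattice \<Longrightarrow> \<exists>i. u i \<noteq> 0 \<Longrightarrow> height s z \<le> height s u"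
    "\<And>u. u \<in> lattice \<Longrightarrow> \<not> parallel z u \<Longrightarrow> height s w \<le> height s u"
    "height s z \<le> height s w" "height s z * height s w ^ (d - 1) \<le> 2 ^ (n + 1)"
proof -
  have nz: "\<exists>i. last_unit i \<noteq> 0"
    by (auto simp: last_unit_def)
  obtain z where z: "z \<in> {u \<in> lattice. \<exists>i. u i \<noteq> 0}"
    "\<And>u. u \<in> {u \<in> lattice. \<exists>i. u i \<noteq> 0} \<Longrightarrow> height s z \<le> height s u"
    by (rule height_minimizer[of "{u \<in> lattice. \<exists>i. u i \<noteq> 0}" s])
      (use last_unit_lattice nz in auto)
  then have zl: "z \<in> lattice" "\<exists>i. z i \<noteq> 0"
    and zmin: "\<And>u. u \<in> lattice \<Longrightarrow> \<exists>i. u i \<noteq> 0 \<Longrightarrow> height s z \<le> height s u"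
    by auto
  obtain v where v: "v \<in> lattice" "\<not> parallel z v" "height s v \<le> exp (\<kappa> * s)"
    using nonparallel_exists[OF zl s] by blast
  obtain w where w: "w \<in> {u \<in> lattice. \<not> parallel z u}"
    "\<And>u. u \<in> {u \<in> lattice. \<not> parallel z u} \<Longrightarrow> height s w \<le> height s u"
    by (rule height_minimizer[of "{u \<in> lattice. \<not> parallel z u}" s]) (use v in auto)
  then have wl: "w \<in> lattice" "\<not> parallel z w"
    and wmin: "\<And>u. u \<in> lattice \<Longrightarrow> \<not> parallel z u \<Longrightarrow> height s w \<le> height s u"
    by auto
  have wnz: "\<exists>i. w i \<noteq> 0"
  proof (rule ccontr)
    assume "\<nexists>i. w i \<noteq> 0"
    then show False
      using wl(2) by (simp add: parallel_def)
  qed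
  have "height s z * height s w ^ (d - 1) \<le> 2 ^ (n + 1)"
    using height_ge_exp[OF wl(1) wnz s] wmin[OF v(1,2)] v(3) zmin[OF wl(1) wnz]
    by (intro first_minima_product_le[OF zl zmin s _ _ _ wmin]) auto
  then show ?thesis
    using that[OF zl wl zmin wmin zmin[OF wl(1) wnz]] by blast
qed

end

section \<open>Transference along the flow\<close>

context theta_matrix
begin

lemma kappa_plus_one: "1 + \<kappa> = real d / real n"
  using n_pos by (simp add: \<kappa>_def field_simps)

text \<open>
  With \<open>t = exp ((1 + c) s)\<close> and \<open>c = (\<kappa> - \<gamma>) / (1 + \<gamma>)\<close>, the conditions \<open>|x| \<le> t\<close> and
  \<open>|\<Theta> x - y| \<le> t powr (- \<gamma>)\<close> together say that the height at time \<open>s\<close> is at most \<open>exp (c s)\<close>.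
  Slightly negative times are included because the backward flow may overshoot \<open>0\<close> by a bounded amount.
\<close>

definition dominated :: "real \<Rightarrow> bool" where
  "dominated \<gamma> \<longleftrightarrow> (\<forall>B. \<exists>C. \<forall>s\<ge>-B. \<exists>z\<in>lattice. (\<exists>i. z i \<noteq> 0) \<and>
     height s z \<le> exp ((\<kappa> - \<gamma>) / (1 + \<gamma>) * s + C))"

lemma last_unit_nonzero: "\<exists>i. last_unit i \<noteq> 0"
  by (auto simp: last_unit_def)

text \<open>For \<gamma> = \<kappa> the slope is 0, and the assertion is Dirichlet's theorem:
  nonzero points of bounded height exist at all times.\<close>

lemma dominated_kappa: "dominated \<kappa>"
  unfolding dominated_def
proof (intro allI exI[of _ "real (n + 1) * ln 2"] impI)
  fix B s :: real
  have e: "exp ((\<kappa> - \<kappa>) / (1 + \<kappa>) * s + real (n + 1) * ln 2) = 2 ^ (n + 1)"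
    by (simp only: exp_of_nat_mult diff_self div_0 mult_zero_left add_0) simp
  show "\<exists>z\<in>lattice. (\<exists>i. z i \<noteq> 0) \<and> height s z \<le> exp ((\<kappa> - \<kappa>) / (1 + \<kappa>) * s + real (n + 1) * ln 2)"
    unfolding e
  proof (cases "0 \<le> s")
    case True
    then obtain z w where z: "z \<in> lattice" "\<exists>i. z i \<noteq> 0" and zw: "height s z \<le> height s w"
      "height s z * height s w ^ (d - 1) \<le> 2 ^ (n + 1)"
      using two_minima[OF True] by metis
    have "height s z \<le> 2 ^ (n + 1)"
    proof (cases "1 \<le> height s z")
      case True
      have "height s z * 1 \<le> height s z * height s w ^ (d - 1)"
        using True zw(1) by (intro mult_left_mono one_le_power) auto
      then show ?thesis
        using zw(2) by simp
    next
      case False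
      then show ?thesis
        using one_le_power[of "2 :: real" "n + 1"] by linarith
    qed
    then show "\<exists>z\<in>lattice. (\<exists>i. z i \<noteq> 0) \<and> height s z \<le> 2 ^ (n + 1)"
      using z by blast
  next
    case False
    then have "\<kappa> * s \<le> 0"
      using kappa_pos by (simp add: mult_le_0_iff)
    then have "height s last_unit \<le> 1"
      by (simp add: height_last_unit)
    also have "1 \<le> (2 :: real) ^ (n + 1)"
      by (rule one_le_power) simp
    finally show "\<exists>z\<in>lattice. (\<exists>i. z i \<noteq> 0) \<and> height s z \<le> 2 ^ (n + 1)"
      using last_unit_lattice last_unit_nonzero by blast
  qed
qed

lemma dominated_admissible:
  assumes adm: "uniform_admissible 1 \<Theta> \<gamma>" and \<gamma>: "-1 < \<gamma>"
  shows "dominated \<gamma>"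
  unfolding dominated_def
proof
  fix B :: real
  define c where "c = (\<kappa> - \<gamma>) / (1 + \<gamma>)"
  have c1: "1 + c = (1 + \<kappa>) / (1 + \<gamma>)"
    using \<gamma> by (simp add: c_def field_simps)
  then have c_pos: "0 < 1 + c"
    using \<gamma> kappa_pos by simp
  have c2: "\<kappa> - \<gamma> * (1 + c) = c"
    unfolding c1 using \<gamma> by (simp add: c_def field_simps)
  obtain T where T: "\<And>t. T \<le> t \<Longrightarrow> \<exists>z\<in>lattice. (\<exists>i. z i \<noteq> 0) \<and> (\<forall>l<m. \<bar>coord z l\<bar> \<le> t) \<and>
    (\<forall>l. m \<le> l \<and> l < d \<longrightarrow> \<bar>coord z l\<bar> \<le> t powr (- \<gamma>))"
    using admissible_imp_lattice_point[OF adm] unfolding eventually_at_top_linorder by blast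
  \<comment> \<open>\<open>s0\<close> is the time belonging to the threshold \<open>T\<close>; on
    the bounded range from \<open>- B\<close> to \<open>s0\<close> the constant \<open>C\<close> is
    large enough for \<open>last_unit\<close>.\<close>
  define s0 where "s0 = ln (max T 1) / (1 + c)"
  define C where "C = \<kappa> * \<bar>s0\<bar> + \<bar>c\<bar> * (\<bar>B\<bar> + \<bar>s0\<bar>)"
  have C: "0 \<le> C"
    using kappa_pos by (simp add: C_def)
  have "\<exists>z\<in>lattice. (\<exists>i. z i \<noteq> 0) \<and> height s z \<le> exp (c * s + C)" if s: "- B \<le> s" for s
  proof (cases "s0 \<le> s")
    case True
    define t where "t = exp ((1 + c) * s)"
    have "ln (max T 1) \<le> (1 + c) * s"
      using True c_pos by (simp add: s0_def field_simps)
    then have "exp (ln (max T 1)) \<le> t"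
      by (simp only: t_def exp_le_cancel_iff)
    moreover have "exp (ln (max T 1)) = max T 1"
      by (rule exp_ln) simp
    ultimately have "max T 1 \<le> t"
      by simp
    then obtain z where z: "z \<in> lattice" "\<exists>i. z i \<noteq> 0" "\<And>l. l < m \<Longrightarrow> \<bar>coord z l\<bar> \<le> t"
      "\<And>l. m \<le> l \<Longrightarrow> l < d \<Longrightarrow> \<bar>coord z l\<bar> \<le> t powr (- \<gamma>)"
      using T[of t] by auto
    have "height s z \<le> exp (c * s)"
      unfolding height_le_iff
    proof (intro allI impI)
      fix l assume l: "l < d"
      show "\<bar>coord z l\<bar> * wt s l \<le> exp (c * s)"
      proof (cases "l < m")
        case True
        have "\<bar>coord z l\<bar> * wt s l \<le> t * exp (- s)"
          using z(3)[OF True] True by (simp add: wt_def)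
        also have "\<dots> = exp (c * s)"
          by (simp add: t_def exp_add[symmetric] algebra_simps)
        finally show ?thesis .
      next
        case False
        have "\<bar>coord z l\<bar> * wt s l \<le> t powr (- \<gamma>) * exp (\<kappa> * s)"
          using z(4)[of l] l False by (simp add: wt_def)
        also have "\<dots> = exp ((\<kappa> - \<gamma> * (1 + c)) * s)"
          by (simp add: t_def powr_def exp_add[symmetric] algebra_simps)
        finally show ?thesis
          by (simp only: c2)
      qed
    qed
    also have "\<dots> \<le> exp (c * s + C)"
      using C by simp
    finally show ?thesis
      using z by blast
  next
    case False
    have "\<bar>s\<bar> \<le> \<bar>B\<bar> + \<bar>s0\<bar>"
      using False s by linarith
    then have "\<bar>c\<bar> * \<bar>s\<bar> \<le> \<bar>c\<bar> * (\<bar>B\<bar> + \<bar>s0\<bar>)"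
      by (rule mult_left_mono) simp
    moreover have "\<bar>c\<bar> * \<bar>s\<bar> \<ge> - (c * s)"
      by (simp add: abs_mult[symmetric])
    moreover have "\<kappa> * s \<le> \<kappa> * \<bar>s0\<bar>"
      using False kappa_pos by (intro mult_left_mono) auto
    ultimately have "\<kappa> * s \<le> c * s + C"
      unfolding C_def by linarith
    then show ?thesis
      using last_unit_lattice last_unit_nonzero by (intro bexI[of _ last_unit]) (auto simp: height_last_unit)
  qed
  then show "\<exists>C. \<forall>s\<ge>-B. \<exists>z\<in>lattice. (\<exists>i. z i \<noteq> 0) \<and> height s z \<le> exp ((\<kappa> - \<gamma>) / (1 + \<gamma>) * s + C)"
    unfolding c_def by blast
qed

text \<open>Being a multiple of \<open>z\<close> does not depend on time: minimality is used at
  \<open>s\<close>, the bound holds at any \<open>s'\<close>. Fixing one coordinate allows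
  \<open>z\<close> to be followed along the flow at a known rate.\<close>

lemma height_parallel_ge:
  assumes z: "z \<in> lattice" "\<exists>i. z i \<noteq> 0"
    and zmin: "\<And>u. u \<in> lattice \<Longrightarrow> \<exists>i. u i \<noteq> 0 \<Longrightarrow> height s z \<le> height s u"
    and u: "u \<in> lattice" "\<exists>i. u i \<noteq> 0" "parallel z u" and l: "l < d"
  shows "\<bar>coord z l\<bar> * wt s' l \<le> height s' u"
proof -
  obtain k :: int where k: "u = (\<lambda>i. of_int k * z i)"
    using parallel_multiple[OF z zmin u(1,3)] by blast
  then have "k \<noteq> 0"
    using u(2) by auto
  then have "1 \<le> \<bar>real_of_int k\<bar>"
    by linarith
  then have "1 * height s' z \<le> \<bar>real_of_int k\<bar> * height s' z"
    by (intro mult_right_mono height_nonneg)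
  then have "height s' z \<le> height s' u"
    unfolding k height_scale by simp
  then show ?thesis
    using height_ge[OF l, of z s'] by linarith
qed

text \<open>The first alternative arises when \<open>z\<close> is expanding, the second when it is
  contracting.\<close>

definition small_pair :: "real \<Rightarrow> real \<Rightarrow> real \<Rightarrow> bool" where
  "small_pair \<gamma> C s \<longleftrightarrow> (\<exists>z\<in>lattice. \<exists>w\<in>lattice. \<exists>a b. \<not> parallel z w \<and>
    height s z = exp a \<and> height s w = exp b \<and> a \<le> b \<and> a + real (d - 1) * b \<le> C \<and>
    (a + \<gamma> * b \<le> (\<kappa> - \<gamma>) * s + C \<or> \<gamma> * a + b \<le> (\<kappa> - \<gamma>) * s + C))"

lemma small_pair_exists:
  assumes dom: "dominated \<gamma>" and \<gamma>: "-1 < \<gamma>"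
  shows "\<exists>C\<ge>0. \<forall>s\<ge>0. small_pair \<gamma> C s"
proof -
  define C0 where "C0 = real (n + 1) * ln 2"
  define c where "c = (\<kappa> - \<gamma>) / (1 + \<gamma>)"
  have C0: "0 \<le> C0" "exp C0 = 2 ^ (n + 1)"
    by (simp_all add: C0_def exp_of_nat_mult del: of_nat_Suc of_nat_add)
  \<comment> \<open>The constant \<open>C0\<close> of the product bound also limits how far the
    backward flow passes time 0.\<close>
  obtain C1 where C1: "\<And>s. - C0 \<le> s \<Longrightarrow> \<exists>z\<in>lattice. (\<exists>i. z i \<noteq> 0) \<and> height s z \<le> exp (c * s + C1)"
    using dom unfolding dominated_def c_def by meson
  define C where "C = max C0 ((1 + \<gamma>) * C1)"
  have c1: "(1 + \<gamma>) * c = \<kappa> - \<gamma>"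
    using \<gamma> by (simp add: c_def)
  have "small_pair \<gamma> C s" if s: "0 \<le> s" for s
  proof -
    obtain z w where z: "z \<in> lattice" "\<exists>i. z i \<noteq> 0" and w: "w \<in> lattice" "\<not> parallel z w"
      and zmin: "\<And>u. u \<in> lattice \<Longrightarrow> \<exists>i. u i \<noteq> 0 \<Longrightarrow> height s z \<le> height s u"
      and wmin: "\<And>u. u \<in> lattice \<Longrightarrow> \<not> parallel z u \<Longrightarrow> height s w \<le> height s u"
      and zw: "height s z \<le> height s w" "height s z * height s w ^ (d - 1) \<le> 2 ^ (n + 1)"
      using two_minima[OF s] by metis
    define a where "a = ln (height s z)"
    define b where "b = ln (height s w)"
    have za: "height s z = exp a"
      using height_pos[OF z, of s] by (simp add: a_def)
    have wb: "height s w = exp b"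
      using height_pos[OF z, of s] zw(1) by (simp add: b_def)
    have ab: "a \<le> b"
      using zw(1) by (simp add: za wb)
    have "exp (a + real (d - 1) * b) \<le> exp C0"
      using zw(2) unfolding za wb C0(2) exp_add exp_of_nat_mult .
    then have sum_ab: "a + real (d - 1) * b \<le> C0"
      by simp
    \<comment> \<open>With this value the lower bounds for parallel and nonparallel vectors agree:
      \<open>a + \<kappa> * \<delta> = b - \<delta>\<close> forward,
      \<open>a + \<delta> = b - \<kappa> * \<delta>\<close> backward.\<close>
    define \<delta> where "\<delta> = (b - a) / (1 + \<kappa>)"
    have \<delta>: "0 \<le> \<delta>" "(1 + \<kappa>) * \<delta> = b - a"
      using ab kappa_pos by (simp_all add: \<delta>_def)
    obtain l where l: "l < d" "height s z = \<bar>coord z l\<bar> * wt s l"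
      using height_attained by blast
    have dominant: "a + \<gamma> * b \<le> (\<kappa> - \<gamma>) * s + C \<or> \<gamma> * a + b \<le> (\<kappa> - \<gamma>) * s + C"
    proof (cases "l < m")
      case False
      have "- C0 \<le> s + \<delta>"
        using s \<delta>(1) C0(1) by linarith
      then obtain u where u: "u \<in> lattice" "\<exists>i. u i \<noteq> 0" "height (s + \<delta>) u \<le> exp (c * (s + \<delta>) + C1)"
        using C1 by blast
      have "exp (b - \<delta>) \<le> height (s + \<delta>) u"
      proof (cases "parallel z u")
        case True
        have "exp (b - \<delta>) = exp (a + \<kappa> * \<delta>)"
          using \<delta>(2) by (simp add: algebra_simps)
        also have "\<dots> = \<bar>coord z l\<bar> * wt (s + \<delta>) l"
          using l(2) False by (simp add: za exp_add wt_def algebra_simps)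
        also have "\<dots> \<le> height (s + \<delta>) u"
          by (rule height_parallel_ge[OF z zmin u(1,2) True l(1)])
        finally show ?thesis .
      next
        case False
        have "exp (b - \<delta>) = exp (- \<delta>) * exp b"
          by (simp add: exp_add[symmetric])
        also have "\<dots> \<le> exp (- \<delta>) * height s u"
          using wmin[OF u(1) False] by (simp add: wb)
        also have "\<dots> \<le> height (s + \<delta>) u"
          by (rule height_shift_forward[OF \<delta>(1)])
        finally show ?thesis .
      qed
      then have "exp (b - \<delta>) \<le> exp (c * (s + \<delta>) + C1)"
        using u(3) by linarith
      then have "b - \<delta> \<le> c * (s + \<delta>) + C1"
        by simp
      then have "(1 + \<gamma>) * (b - \<delta>) \<le> (1 + \<gamma>) * (c * (s + \<delta>) + C1)"
        using \<gamma> by (intro mult_left_mono) auto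
      also have "\<dots> = (\<kappa> - \<gamma>) * (s + \<delta>) + (1 + \<gamma>) * C1"
        unfolding c1[symmetric] by (simp add: algebra_simps)
      also have "\<dots> \<le> (\<kappa> - \<gamma>) * (s + \<delta>) + C"
        by (simp add: C_def)
      finally have "(1 + \<gamma>) * b - (1 + \<kappa>) * \<delta> \<le> (\<kappa> - \<gamma>) * s + C"
        by (simp add: algebra_simps)
      then show ?thesis
        unfolding \<delta>(2) by (simp add: algebra_simps)
    next
      case True
      have "- s \<le> a"
        using height_ge_exp[OF z s] by (simp add: za)
      \<comment> \<open>The bound on a + (d - 1) b and \<open>- s \<le> a\<close> give (d - 1) (b -
        a) \<le> C0 + d s. Since d \<delta> = n (b - a) and n \<le> d - 1, it follows that d
        \<delta> \<le> C0 + d s.\<close>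
      have "- C0 \<le> s - \<delta>"
      proof -
        have d1: "real (d - 1) = real d - 1" "real n \<le> real d - 1" "0 < real d"
          using m_pos by (auto simp: of_nat_diff)
        have "(real d / real n) * \<delta> = b - a"
          using \<delta>(2) by (simp only: kappa_plus_one)
        moreover have "real d * \<delta> = real n * ((real d / real n) * \<delta>)"
          using n_pos by (simp del: of_nat_add)
        ultimately have "real d * \<delta> = real n * (b - a)"
          by (simp only:)
        then have "(real d - 1) * (real d * \<delta>) = real n * ((real d - 1) * b - (real d - 1) * a)"
          by (simp only: mult.left_commute[of "real d - 1"] right_diff_distrib[symmetric])
        also have "\<dots> \<le> real n * (C0 + real d * s)"
        proof (rule mult_left_mono)
          have "- (real d * a) \<le> real d * s"
            using \<open>- s \<le> a\<close> d1(3) by (simp add: mult_left_mono[of "- a" s "real d", simplified])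
          then show "(real d - 1) * b - (real d - 1) * a \<le> C0 + real d * s"
            using sum_ab d1(1) by (simp add: algebra_simps)
        qed simp
        also have "\<dots> \<le> (real d - 1) * (C0 + real d * s)"
          using d1 C0(1) s by (intro mult_right_mono) auto
        finally have "real d * \<delta> \<le> C0 + real d * s"
          using d1 n_pos by (simp add: mult_le_cancel_left)
        also have "\<dots> \<le> real d * (C0 + s)"
          using mult_right_mono[of 1 "real d" C0] C0(1) d1 n_pos by (simp add: algebra_simps)
        finally have "\<delta> \<le> C0 + s"
          using d1(3) by (simp add: mult_le_cancel_left)
        then show ?thesis
          by simp
      qed
      then obtain u where u: "u \<in> lattice" "\<exists>i. u i \<noteq> 0" "height (s - \<delta>) u \<le> exp (c * (s - \<delta>) + C1)"
        using C1 by blast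
      have "exp (a + \<delta>) \<le> height (s - \<delta>) u"
      proof (cases "parallel z u")
        case par: True
        have "wt (s - \<delta>) l = wt s l * exp \<delta>"
          using True by (simp add: wt_def mult_exp_exp)
        then have "exp (a + \<delta>) = \<bar>coord z l\<bar> * wt (s - \<delta>) l"
          using l(2) by (simp add: za exp_add)
        also have "\<dots> \<le> height (s - \<delta>) u"
          by (rule height_parallel_ge[OF z zmin u(1,2) par l(1)])
        finally show ?thesis .
      next
        case False
        have "exp (a + \<delta>) = exp (b - \<kappa> * \<delta>)"
          using \<delta>(2) by (simp add: algebra_simps)
        also have "\<dots> = exp (- \<kappa> * \<delta>) * exp b"
          by (simp add: exp_add[symmetric])
        also have "\<dots> \<le> exp (- \<kappa> * \<delta>) * height s u"
          using wmin[OF u(1) False] by (simp add: wb)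
        also have "\<dots> \<le> height (s - \<delta>) u"
          by (rule height_shift_backward[OF \<delta>(1)])
        finally show ?thesis .
      qed
      then have "exp (a + \<delta>) \<le> exp (c * (s - \<delta>) + C1)"
        using u(3) by linarith
      then have "a + \<delta> \<le> c * (s - \<delta>) + C1"
        by simp
      then have "(1 + \<gamma>) * (a + \<delta>) \<le> (1 + \<gamma>) * (c * (s - \<delta>) + C1)"
        using \<gamma> by (intro mult_left_mono) auto
      also have "\<dots> = (\<kappa> - \<gamma>) * (s - \<delta>) + (1 + \<gamma>) * C1"
        unfolding c1[symmetric] by (simp add: algebra_simps)
      also have "\<dots> \<le> (\<kappa> - \<gamma>) * (s - \<delta>) + C"
        by (simp add: C_def)
      finally have "(1 + \<gamma>) * a + (1 + \<kappa>) * \<delta> \<le> (\<kappa> - \<gamma>) * s + C"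
        by (simp add: algebra_simps)
      then show ?thesis
        unfolding \<delta>(2) by (simp add: algebra_simps)
    qed
    have "a + real (d - 1) * b \<le> C"
      using sum_ab by (simp add: C_def)
    then show ?thesis
      unfolding small_pair_def
      by (intro bexI[of _ z] bexI[of _ w] exI[of _ a] exI[of _ b] conjI z(1) w za wb ab dominant)
  qed
  moreover have "0 \<le> C"
    using C0(1) by (simp add: C_def)
  ultimately show ?thesis
    by blast
qed

end

section \<open>Linear optimization over the two logarithmic minima\<close>

text \<open>
  The maximum of \<open>a + b\<close> at \<open>s = 1\<close> subject to \<open>a + (D - 1) b \<le> 0\<close> and
  \<open>a + \<gamma> b \<le> \<kappa> - \<gamma>\<close> (if \<open>\<gamma> \<le> 1\<close>) or \<open>\<gamma> a + b \<le> \<kappa> - \<gamma>\<close> (if \<open>\<gamma> > 1\<close>); the other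
  alternative is weaker because \<open>a \<le> b\<close>.
\<close>

definition joint_slope :: "real \<Rightarrow> real \<Rightarrow> real \<Rightarrow> real" where
  "joint_slope D \<kappa> \<gamma> = (D - 2) * (\<kappa> - \<gamma>) / (if \<gamma> \<le> 1 then D - 1 - \<gamma> else (D - 1) * \<gamma> - 1)"

lemma joint_slope_bound:
  fixes a b C D \<gamma> \<kappa> s :: real
  assumes ab: "a \<le> b" "a + (D - 1) * b \<le> C"
    and alt: "a + \<gamma> * b \<le> (\<kappa> - \<gamma>) * s + C \<or> \<gamma> * a + b \<le> (\<kappa> - \<gamma>) * s + C"
    and "0 \<le> s" "0 < \<kappa>" "\<kappa> \<le> \<gamma>" "0 \<le> C" "3 \<le> D"
  shows "a + b \<le> joint_slope D \<kappa> \<gamma> * s + 2 * C"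
proof -
  define E where "E = (\<kappa> - \<gamma>) * s"
  define q where "q = (if \<gamma> \<le> 1 then D - 1 - \<gamma> else (D - 1) * \<gamma> - 1)"
  have \<gamma>: "0 < \<gamma>"
    using assms by linarith
  have E: "E \<le> 0"
    using assms by (simp add: E_def mult_le_0_iff)
  have Dg: "D * (1 - \<gamma>) \<ge> 0" if "\<gamma> \<le> 1"
    using that assms by simp
  have Dg': "(D - 2) * (\<gamma> - 1) \<ge> 0" "D * (\<gamma> - 1) \<ge> 0" if "1 \<le> \<gamma>"
    using that assms by simp_all
  have q: "0 < q"
  proof (cases "\<gamma> \<le> 1")
    case True
    then show ?thesis
      using \<open>3 \<le> D\<close> by (simp add: q_def)
  next
    case False
    then have "2 * 1 \<le> (D - 1) * \<gamma>"
      using \<open>3 \<le> D\<close> by (intro mult_mono) auto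
    then show ?thesis
      using False by (simp add: q_def)
  qed
  \<comment> \<open>Because \<open>E \<le> 0\<close>, this puts the value
    \<open>2 * E / (1 + \<gamma>)\<close> reached in \<open>balanced\<close> below the claimed
    one.\<close>
  have q2: "(D - 2) * (1 + \<gamma>) \<le> 2 * q"
    using Dg Dg'(2) by (cases "\<gamma> \<le> 1") (auto simp: q_def algebra_simps)
  have combined: "a + b \<le> (D - 2) * E / q + 2 * C" if "q * (a + b) \<le> (D - 2) * E + q * C"
  proof -
    have "a + b \<le> ((D - 2) * E + q * C) / q"
      using that q by (simp add: pos_le_divide_eq mult.commute)
    also have "\<dots> = (D - 2) * E / q + C"
      using q by (simp add: add_divide_distrib)
    finally show ?thesis
      using assms by linarith
  qed
  have balanced: "a + b \<le> (D - 2) * E / q + 2 * C" if "(1 + \<gamma>) * (a + b) \<le> 2 * (E + C)"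
  proof -
    have "a + b \<le> 2 * (E + C) / (1 + \<gamma>)"
      using that \<gamma> by (simp add: pos_le_divide_eq mult.commute)
    also have "\<dots> = 2 * E / (1 + \<gamma>) + 2 * C / (1 + \<gamma>)"
      by (simp add: add_divide_distrib distrib_left)
    also have "2 * C / (1 + \<gamma>) \<le> 2 * C"
      using \<gamma> assms by (simp add: pos_divide_le_eq mult_le_cancel_left1)
    also have "2 * E / (1 + \<gamma>) \<le> (D - 2) * E / q"
    proof -
      have "2 * q * E \<le> (D - 2) * (1 + \<gamma>) * E"
        using q2 E by (rule mult_right_mono_neg)
      then show ?thesis
        using q \<gamma> by (simp add: divide_le_eq le_divide_eq mult_ac)
    qed
    finally show ?thesis
      by simp
  qed
  have "a + b \<le> (D - 2) * E / q + 2 * C"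
  proof (cases "\<gamma> \<le> 1")
    case True
    then have q_eq: "q = D - 1 - \<gamma>"
      by (simp add: q_def)
    from alt show ?thesis
    proof
      assume alt: "a + \<gamma> * b \<le> (\<kappa> - \<gamma>) * s + C"
      \<comment> \<open>The dual multipliers 1 - \<gamma> and D - 2 give \<open>a\<close> and
        \<open>b\<close> the same coefficient \<open>q\<close>.\<close>
      have "(1 - \<gamma>) * (a + (D - 1) * b) \<le> (1 - \<gamma>) * C" "(D - 2) * (a + \<gamma> * b) \<le> (D - 2) * (E + C)"
        using True ab(2) alt assms by (auto intro!: mult_left_mono simp: E_def)
      then show ?thesis
        by (intro combined) (simp add: q_eq algebra_simps)
    next
      assume alt: "\<gamma> * a + b \<le> (\<kappa> - \<gamma>) * s + C"
      have "0 \<le> (1 - \<gamma>) * (b - a)"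
        using True ab(1) by simp
      then have "(1 + \<gamma>) * (a + b) \<le> 2 * (\<gamma> * a + b)"
        by (simp add: algebra_simps)
      then show ?thesis
        using alt by (intro balanced) (simp add: E_def)
    qed
  next
    case False
    then have q_eq: "q = (D - 1) * \<gamma> - 1"
      by (simp add: q_def)
    from alt show ?thesis
    proof
      assume alt: "a + \<gamma> * b \<le> (\<kappa> - \<gamma>) * s + C"
      have "0 \<le> (\<gamma> - 1) * (b - a)"
        using False ab(1) by simp
      then have "(1 + \<gamma>) * (a + b) \<le> 2 * (a + \<gamma> * b)"
        by (simp add: algebra_simps)
      then show ?thesis
        using alt by (intro balanced) (simp add: E_def)
    next
      assume alt: "\<gamma> * a + b \<le> (\<kappa> - \<gamma>) * s + C"
      \<comment> \<open>Now the multipliers are \<gamma> - 1 and D - 2; the constants fall short of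
        \<open>q * C\<close> by \<open>(D - 2) * (\<gamma> - 1) * C\<close>.\<close>
      have "(\<gamma> - 1) * (a + (D - 1) * b) \<le> (\<gamma> - 1) * C" "(D - 2) * (\<gamma> * a + b) \<le> (D - 2) * (E + C)"
        using False ab(2) alt assms by (auto intro!: mult_left_mono simp: E_def)
      moreover have "0 \<le> (D - 2) * (\<gamma> - 1) * C"
        using Dg'(1) False assms by simp
      ultimately show ?thesis
        by (intro combined) (simp add: q_eq algebra_simps)
    qed
  qed
  also have "(D - 2) * E / q = joint_slope D \<kappa> \<gamma> * s"
    by (simp add: joint_slope_def q_def E_def)
  finally show ?thesis .
qed

text \<open>The factor (m + n) / n equals 1 + \<kappa> and is split off because it cancels from (1 +
  \<kappa>) / w in \<open>exponent_two_ge\<close>.\<close>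

lemma joint_slope_formula:
  fixes m n \<gamma> :: real
  assumes "1 \<le> m" "1 \<le> n" "3 \<le> m + n" "0 \<le> \<gamma>"
  shows "2 + joint_slope (m + n) (m / n) \<gamma> = (m + n) / n *
    (if \<gamma> \<le> 1 then (n * (1 - \<gamma>) + (m + n - 2)) / (m + n - 1 - \<gamma>)
     else (n * \<gamma> + m - 2) / ((m + n - 1) * \<gamma> - 1))"
proof -
  define r where "r = m / n"
  define q where "q = (if \<gamma> \<le> 1 then m + n - 1 - \<gamma> else (m + n - 1) * \<gamma> - 1)"
  define N where "N = (if \<gamma> \<le> 1 then n * (1 - \<gamma>) + (m + n - 2) else n * \<gamma> + m - 2)"
  have r: "(m + n) / n = r + 1" "(r + 1) * n = m + n"
    using assms by (simp_all add: r_def field_simps)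
  have q: "0 < q"
  proof (cases "\<gamma> \<le> 1")
    case True
    then show ?thesis
      using assms by (simp add: q_def)
  next
    case False
    then have "2 * 1 \<le> (m + n - 1) * \<gamma>"
      using assms(3) by (intro mult_mono) auto
    then show ?thesis
      using False by (simp add: q_def)
  qed
  have "(r + 1) * N = (if \<gamma> \<le> 1 then ((r + 1) * n) * (1 - \<gamma>) + (r + 1) * (m + n - 2)
      else ((r + 1) * n) * (\<gamma> - 1) + (r + 1) * (m + n - 2))"
    by (simp add: N_def algebra_simps)
  then have "2 * q + (m + n - 2) * (r - \<gamma>) = (r + 1) * N"
    unfolding r(2) q_def by (simp add: algebra_simps split: if_splits)
  moreover have "2 + (m + n - 2) * (r - \<gamma>) / q = (2 * q + (m + n - 2) * (r - \<gamma>)) / q"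
    using q by (simp add: add_divide_distrib)
  moreover have "joint_slope (m + n) r \<gamma> = (m + n - 2) * (r - \<gamma>) / q"
    by (simp only: joint_slope_def q_def)
  moreover have "(if \<gamma> \<le> 1 then (n * (1 - \<gamma>) + (m + n - 2)) / (m + n - 1 - \<gamma>)
     else (n * \<gamma> + m - 2) / ((m + n - 1) * \<gamma> - 1)) = N / q"
    by (simp add: N_def q_def)
  ultimately show ?thesis
    unfolding r(1) r_def[symmetric] by simp
qed

section \<open>From families of short multivectors to exponents\<close>

context theta_matrix
begin

text \<open>At \<open>t = K * exp (w * s)\<close> each level lowers the logarithm by (1 + \<kappa>)
  s, asymptotically (1 + \<kappa>) / w times \<open>ln t\<close>. The bounded loss caused by
  \<open>K\<close> is absorbed by taking \<gamma> strictly below the limit value.\<close>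

lemma exponent_ge:
  assumes w: "0 < w" and K: "0 < K"
    and family: "\<And>s. 0 \<le> s \<Longrightarrow> \<exists>Z\<in>ext_lattice d p. Z \<noteq> (\<lambda>_. 0) \<and> (\<forall>\<sigma>\<subseteq>{..<m}.
      sup_norm d (wedge (L_mv \<Theta> \<sigma>) Z) \<le> K * exp (w * s - real (card \<sigma> - (m - p)) * (1 + \<kappa>) * s))"
  shows "ereal ((1 + \<kappa>) / w - 1) \<le> uniform_exponent p \<Theta>"
proof -
  define A where "A = (1 + \<kappa>) / w"
  define G where "G = A - 1"
  have dim: "dim_row \<Theta> = n" "dim_col \<Theta> = m"
    using Theta_carrier by auto
  have adm: "uniform_admissible p \<Theta> \<gamma>" if \<gamma>: "-1 < \<gamma>" "\<gamma> < G" for \<gamma>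
  proof -
    define k0 where "k0 = max 0 (real m - real p)"
    \<comment> \<open>This threshold is (1 + \<gamma>) ln t \<le> A (ln t - ln K) solved for
      \<open>ln t\<close>.\<close>
    have "\<forall>\<^sub>F t in at_top. A * ln K / (A - (1 + \<gamma>)) \<le> ln t"
      using ln_at_top by (simp add: filterlim_at_top)
    then have "\<forall>\<^sub>F t :: real in at_top. \<exists>Z \<in> ext_lattice d p. Z \<noteq> (\<lambda>_. 0) \<and>
        (\<forall>k\<le>m. (MAX \<sigma>\<in>index_sets m k. sup_norm d (wedge (L_mv \<Theta> \<sigma>) Z))
                  \<le> t powr (1 - (real k - k0) * (1 + \<gamma>)))"
      using eventually_ge_at_top[of "max K 1"]
    proof eventually_elim
      case (elim t)
      define s where "s = ln (t / K) / w"
      have t: "0 < t" "1 \<le> t" "K \<le> t"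
        using elim by auto
      have s: "0 \<le> s" "w * s = ln t - ln K"
        using t K w by (simp_all add: s_def ln_div)
      have exps: "(1 + \<gamma>) * ln t \<le> (1 + \<kappa>) * s"
      proof -
        have "0 < A - (1 + \<gamma>)"
          using \<gamma>(2) by (simp add: G_def)
        then have "A * ln K \<le> ln t * (A - (1 + \<gamma>))"
          using elim(1) by (simp only: pos_divide_le_eq)
        then have "(1 + \<gamma>) * ln t \<le> A * (ln t - ln K)"
          by (simp add: algebra_simps)
        also have "\<dots> = (1 + \<kappa>) * s"
          unfolding s(2)[symmetric] A_def using w by simp
        finally show ?thesis .
      qed
      obtain Z where Z: "Z \<in> ext_lattice d p" "Z \<noteq> (\<lambda>_. 0)"
        and bound: "\<And>\<sigma>. \<sigma> \<subseteq> {..<m} \<Longrightarrow> sup_norm d (wedge (L_mv \<Theta> \<sigma>) Z)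
          \<le> K * exp (w * s - real (card \<sigma> - (m - p)) * (1 + \<kappa>) * s)"
        using family[OF s(1)] by blast
      have "(MAX \<sigma>\<in>index_sets m k. sup_norm d (wedge (L_mv \<Theta> \<sigma>) Z))
          \<le> t powr (1 - (real k - k0) * (1 + \<gamma>))" if k: "k \<le> m" for k
      proof -
        have "sup_norm d (wedge (L_mv \<Theta> \<sigma>) Z) \<le> t powr (1 - (real k - k0) * (1 + \<gamma>))"
          if \<sigma>: "\<sigma> \<in> index_sets m k" for \<sigma>
        proof -
          let ?j = "real (k - (m - p))"
          \<comment> \<open>Below level \<open>k0\<close> the truncation at 0 only strengthens the
            bound; for p > m both \<open>k0\<close> and \<open>m - p\<close> are 0.\<close>
          have "real k - k0 \<le> ?j"
            by (auto simp: k0_def)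
          then have "(real k - k0) * ((1 + \<gamma>) * ln t) \<le> ?j * ((1 + \<gamma>) * ln t)"
            using \<gamma>(1) t(2) by (intro mult_right_mono) auto
          also have "\<dots> \<le> ?j * ((1 + \<kappa>) * s)"
            by (intro mult_left_mono exps) auto
          finally have le: "w * s - ?j * (1 + \<kappa>) * s + ln K \<le> (1 - (real k - k0) * (1 + \<gamma>)) * ln t"
            using s(2) by (simp add: algebra_simps)
          have "sup_norm d (wedge (L_mv \<Theta> \<sigma>) Z) \<le> K * exp (w * s - ?j * (1 + \<kappa>) * s)"
            using bound[of \<sigma>] \<sigma> by (auto simp: index_sets_def)
          also have "\<dots> = exp (w * s - ?j * (1 + \<kappa>) * s + ln K)"
            using K by (simp add: exp_add)
          also have "\<dots> \<le> exp ((1 - (real k - k0) * (1 + \<gamma>)) * ln t)"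
            using le by simp
          also have "\<dots> = t powr (1 - (real k - k0) * (1 + \<gamma>))"
            using t(1) by (simp add: powr_def)
          finally show ?thesis .
        qed
        moreover have "finite (index_sets m k)"
          by (rule finite_subset[of _ "Pow {..<m}"]) (auto simp: index_sets_def)
        moreover have "{..<k} \<in> index_sets m k"
          using k by (auto simp: index_sets_def)
        ultimately show ?thesis
          by (subst Max_le_iff) auto
      qed
      then show ?case
        using Z by blast
    qed
    then show ?thesis
      unfolding uniform_admissible_def dim Let_def k0_def .
  qed
  have "-1 < G"
    using w kappa_pos by (simp add: G_def A_def)
  show ?thesis
    unfolding A_def[symmetric] G_def[symmetric] uniform_exponent_def le_Sup_iff
  proof (intro allI impI)
    fix y assume "y < ereal G"
    \<comment> \<open>\<open>adm\<close> covers only \<gamma> above -1.\<close>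
    then have "max y (-1) < ereal G"
      using \<open>-1 < G\<close> by (simp add: one_ereal_def)
    then obtain x where x: "max y (-1) < x" "x < ereal G"
      using dense by blast
    then obtain \<gamma> where \<gamma>: "x = ereal \<gamma>"
      by (cases x) (auto simp: max_def split: if_splits)
    then have "y < ereal \<gamma>" "-1 < \<gamma>" "\<gamma> < G"
      using x by (auto simp: one_ereal_def)
    then show "\<exists>x\<in>ereal ` {\<gamma>. uniform_admissible p \<Theta> \<gamma>}. y < x"
      using adm by blast
  qed
qed

lemma vec_mv_nonzero:
  assumes "z \<in> lattice" "\<exists>i. z i \<noteq> 0"
  shows "vec_mv d z \<noteq> (\<lambda>_. 0)"
proof -
  obtain i where i: "z i \<noteq> 0"
    using assms(2) by blast
  then have "i < d"
    using assms(1) by (fastforce simp: lattice_def not_less[symmetric])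
  then have "vec_mv d z {i} \<noteq> 0"
    using i by (simp add: vec_mv_singleton)
  then show ?thesis
    by metis
qed

lemma wedge_nonzero:
  assumes "z \<in> lattice" "w \<in> lattice" "\<not> parallel z w"
  shows "wedge (vec_mv d z) (vec_mv d w) \<noteq> (\<lambda>_. 0)"
proof -
  obtain i j where ij: "z i * w j \<noteq> z j * w i"
    using assms(3) by (auto simp: parallel_def)
  have supp: "z k = 0" "w k = 0" if "\<not> k < d" for k
    using assms(1,2) that by (auto simp: lattice_def)
  have "i < d" "j < d"
    using ij supp by (metis mult_zero_left mult_zero_right)+
  moreover have "\<exists>i j. i < j \<and> j < d \<and> z i * w j \<noteq> z j * w i"
  proof (cases "i < j")
    case True
    then show ?thesis
      using ij \<open>j < d\<close> by blast
  next
    case False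
    then have "j < i"
      using ij by (metis linorder_neqE_nat)
    then show ?thesis
      using ij \<open>i < d\<close> by metis
  qed
  then obtain i j where "i < j" "j < d" "z i * w j \<noteq> z j * w i"
    by blast
  then have "wedge (vec_mv d z) (vec_mv d w) {i, j} \<noteq> 0"
    by (simp add: vec_mv_wedge_pair)
  then show ?thesis
    by metis
qed

text \<open>Points of bounded height form a family with w = 1. The bound also keeps the first
  exponent away from minus infinity.\<close>

lemma exponent_one_ge: "ereal \<kappa> \<le> uniform_exponent 1 \<Theta>"
proof -
  obtain C where C: "\<And>s. 0 \<le> s \<Longrightarrow> \<exists>z\<in>lattice. (\<exists>i. z i \<noteq> 0) \<and> height s z \<le> exp C"
    using dominated_kappa[unfolded dominated_def, rule_format, of 0] by auto
  obtain K where K: "0 < K" and bound: "\<And>s z \<sigma>. 0 \<le> s \<Longrightarrow> \<sigma> \<subseteq> {..<m} \<Longrightarrow>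
      sup_norm d (wedge (L_mv \<Theta> \<sigma>) (vec_mv d z))
      \<le> K * (height s z * exp (s - real (1 - (m - card \<sigma>)) * (1 + \<kappa>) * s))"
    by (rule wedge_one_bound) (rule that; blast)
  have "ereal ((1 + \<kappa>) / 1 - 1) \<le> uniform_exponent 1 \<Theta>"
  proof (rule exponent_ge)
    show "0 < K * exp C"
      using K by simp
    fix s :: real assume s: "0 \<le> s"
    obtain z where z: "z \<in> lattice" "\<exists>i. z i \<noteq> 0" "height s z \<le> exp C"
      using C[OF s] by blast
    have "sup_norm d (wedge (L_mv \<Theta> \<sigma>) (vec_mv d z))
        \<le> K * exp C * exp (1 * s - real (card \<sigma> - (m - 1)) * (1 + \<kappa>) * s)" if \<sigma>: "\<sigma> \<subseteq> {..<m}" for \<sigma>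
    proof -
      have "card \<sigma> \<le> m"
        using card_mono[OF _ \<sigma>] by simp
      then have j: "1 - (m - card \<sigma>) = card \<sigma> - (m - 1)"
        using m_pos by linarith
      have "sup_norm d (wedge (L_mv \<Theta> \<sigma>) (vec_mv d z))
          \<le> K * (height s z * exp (s - real (card \<sigma> - (m - 1)) * (1 + \<kappa>) * s))"
        using bound[OF s \<sigma>, of z] by (simp only: j)
      also have "\<dots> \<le> K * (exp C * exp (s - real (card \<sigma> - (m - 1)) * (1 + \<kappa>) * s))"
        using z(3) K by (intro mult_left_mono mult_right_mono) auto
      finally show ?thesis
        by (simp add: mult.assoc)
    qed
    moreover have "vec_mv d z \<in> ext_lattice d 1"
      using z(1) by (intro vec_mv_ext_lattice) (auto simp: lattice_def)
    ultimately show "\<exists>Z\<in>ext_lattice d 1. Z \<noteq> (\<lambda>_. 0) \<and> (\<forall>\<sigma>\<subseteq>{..<m}. sup_norm d (wedge (L_mv \<Theta> \<sigma>) Z)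
        \<le> K * exp C * exp (1 * s - real (card \<sigma> - (m - 1)) * (1 + \<kappa>) * s))"
      using vec_mv_nonzero[OF z(1,2)] by blast
  qed simp
  then show ?thesis
    by simp
qed

lemma exponent_two_ge:
  assumes dom: "dominated \<gamma>" and \<gamma>: "\<kappa> \<le> \<gamma>" and d3: "3 \<le> d"
    \<comment> \<open>For \<open>m = 1\<close> no coordinate of degree two in \<open>x\<close> exists, so the leading level shifts by one.\<close>
    and w_def: "w = 2 + joint_slope (real d) \<kappa> \<gamma> - (if m = 1 then 1 + \<kappa> else 0)" and w: "0 < w"
  shows "ereal ((1 + \<kappa>) / w - 1) \<le> uniform_exponent 2 \<Theta>"
proof -
  have "-1 < \<gamma>"
    using \<gamma> kappa_pos by linarith
  then obtain C where C: "0 \<le> C" and points: "\<And>s. 0 \<le> s \<Longrightarrow> small_pair \<gamma> C s"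
    using small_pair_exists[OF dom] by blast
  obtain K where K: "0 < K" and bound: "\<And>s z w \<sigma>. 0 \<le> s \<Longrightarrow> \<sigma> \<subseteq> {..<m} \<Longrightarrow>
      sup_norm d (wedge (L_mv \<Theta> \<sigma>) (wedge (vec_mv d z) (vec_mv d w)))
      \<le> K * (height s z * height s w * exp (2 * s - real (2 - (m - card \<sigma>)) * (1 + \<kappa>) * s))"
    by (rule wedge_two_bound) (rule that; blast)
  show ?thesis
  proof (rule exponent_ge[OF w])
    show "0 < K * exp (2 * C)"
      using K by simp
    fix s :: real assume s: "0 \<le> s"
    obtain z v a b where zv: "z \<in> lattice" "v \<in> lattice" "\<not> parallel z v"
      and h: "height s z = exp a" "height s v = exp b"
      and ab: "a \<le> b" "a + real (d - 1) * b \<le> C"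
        "a + \<gamma> * b \<le> (\<kappa> - \<gamma>) * s + C \<or> \<gamma> * a + b \<le> (\<kappa> - \<gamma>) * s + C"
      using points[OF s] unfolding small_pair_def by (elim bexE exE conjE) (rule that)
    have "real (d - 1) = real d - 1"
      using d3 by (simp add: of_nat_diff)
    then have sum_ab: "a + b \<le> joint_slope (real d) \<kappa> \<gamma> * s + 2 * C"
      using ab s kappa_pos \<gamma> C d3 by (intro joint_slope_bound) auto
    let ?Z = "wedge (vec_mv d z) (vec_mv d v)"
    define \<epsilon> :: real where "\<epsilon> = (if m = 1 then 1 else 0)"
    have w_eq: "w = 2 + joint_slope (real d) \<kappa> \<gamma> - \<epsilon> * (1 + \<kappa>)"
      by (simp add: w_def \<epsilon>_def)
    have level: "sup_norm d (wedge (L_mv \<Theta> \<sigma>) ?Z)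
        \<le> K * exp (2 * C) * exp (w * s - real (card \<sigma> - (m - 2)) * (1 + \<kappa>) * s)" if \<sigma>: "\<sigma> \<subseteq> {..<m}" for \<sigma>
    proof -
      have "card \<sigma> \<le> m"
        using card_mono[OF _ \<sigma>] by simp
      \<comment> \<open>For \<open>m = 1\<close> the truncated \<open>m - 2\<close> is 0 instead of
        -1, which loses one level.\<close>
      then have "2 - (m - card \<sigma>) = card \<sigma> - (m - 2) + (if m = 1 then 1 else 0)"
        using m_pos by auto
      then have j: "real (2 - (m - card \<sigma>)) = real (card \<sigma> - (m - 2)) + \<epsilon>"
        by (simp add: \<epsilon>_def)
      have "a + b + (2 * s - real (2 - (m - card \<sigma>)) * (1 + \<kappa>) * s)
          \<le> 2 * C + (w * s - real (card \<sigma> - (m - 2)) * (1 + \<kappa>) * s)"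
        using sum_ab unfolding j w_eq by (simp add: algebra_simps)
      then have "exp (a + b + (2 * s - real (2 - (m - card \<sigma>)) * (1 + \<kappa>) * s))
          \<le> exp (2 * C + (w * s - real (card \<sigma> - (m - 2)) * (1 + \<kappa>) * s))"
        by (simp only: exp_le_cancel_iff)
      then have "height s z * height s v * exp (2 * s - real (2 - (m - card \<sigma>)) * (1 + \<kappa>) * s)
          \<le> exp (2 * C) * exp (w * s - real (card \<sigma> - (m - 2)) * (1 + \<kappa>) * s)"
        unfolding h exp_add .
      then have "K * (height s z * height s v * exp (2 * s - real (2 - (m - card \<sigma>)) * (1 + \<kappa>) * s))
          \<le> K * (exp (2 * C) * exp (w * s - real (card \<sigma> - (m - 2)) * (1 + \<kappa>) * s))"
        by (rule mult_left_mono) (rule less_imp_le[OF K])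
      then show ?thesis
        unfolding mult.assoc[of K] by (rule order.trans[OF bound[OF s \<sigma>]])
    qed
    have "?Z \<in> ext_lattice d (1 + 1)"
      using zv by (intro wedge_ext_lattice vec_mv_ext_lattice) (auto simp: lattice_def)
    then have "?Z \<in> ext_lattice d 2"
      by (simp only: one_add_one)
    then show "\<exists>Z\<in>ext_lattice d 2. Z \<noteq> (\<lambda>_. 0) \<and> (\<forall>\<sigma>\<subseteq>{..<m}. sup_norm d (wedge (L_mv \<Theta> \<sigma>) Z)
        \<le> K * exp (2 * C) * exp (w * s - real (card \<sigma> - (m - 2)) * (1 + \<kappa>) * s))"
      by (intro bexI[of _ ?Z] conjI allI impI wedge_nonzero[OF zv] level)
  qed
qed

text \<open>The slope is (1 + \<kappa>) / (1 + \<gamma>) - 1, decreasing in \<gamma>; at negative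
  times the comparison reverses, and \<open>(c - c') * B\<close> compensates. The supremum supplies
  only some admissible value above \<gamma>, hence the need for this.\<close>

lemma dominated_mono:
  assumes dom: "dominated \<gamma>'" and \<gamma>: "-1 < \<gamma>" "\<gamma> \<le> \<gamma>'"
  shows "dominated \<gamma>"
  unfolding dominated_def
proof
  fix B :: real
  define c where "c = (\<kappa> - \<gamma>) / (1 + \<gamma>)"
  define c' where "c' = (\<kappa> - \<gamma>') / (1 + \<gamma>')"
  have shift: "(\<kappa> - x) / (1 + x) = (1 + \<kappa>) / (1 + x) - 1" if "-1 < x" for x
    using that by (simp add: field_simps)
  have "(1 + \<kappa>) / (1 + \<gamma>') \<le> (1 + \<kappa>) / (1 + \<gamma>)"
    using \<gamma> kappa_pos by (intro divide_left_mono) auto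
  then have "c' \<le> c"
    using \<gamma> by (simp add: c_def c'_def shift)
  obtain C where C: "\<And>s. - B \<le> s \<Longrightarrow> \<exists>z\<in>lattice. (\<exists>i. z i \<noteq> 0) \<and> height s z \<le> exp (c' * s + C)"
    using dom unfolding dominated_def c'_def by meson
  have "\<exists>z\<in>lattice. (\<exists>i. z i \<noteq> 0) \<and> height s z \<le> exp (c * s + (C + (c - c') * B))" if s: "- B \<le> s" for s
  proof -
    obtain z where z: "z \<in> lattice" "\<exists>i. z i \<noteq> 0" "height s z \<le> exp (c' * s + C)"
      using C[OF s] by blast
    have "0 \<le> (c - c') * (s + B)"
      using \<open>c' \<le> c\<close> s by simp
    then have "c' * s + C \<le> c * s + (C + (c - c') * B)"
      by (simp add: algebra_simps)
    then have "exp (c' * s + C) \<le> exp (c * s + (C + (c - c') * B))"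
      by (simp only: exp_le_cancel_iff)
    then have "height s z \<le> exp (c * s + (C + (c - c') * B))"
      by (rule order.trans[OF z(3)])
    then show ?thesis
      using z(1,2) by blast
  qed
  then show "\<exists>C. \<forall>s\<ge>-B. \<exists>z\<in>lattice. (\<exists>i. z i \<noteq> 0) \<and> height s z \<le> exp ((\<kappa> - \<gamma>) / (1 + \<gamma>) * s + C)"
    unfolding c_def by (intro exI allI impI)
qed

lemma dominated_below_exponent:
  assumes "\<kappa> \<le> \<gamma>" "ereal \<gamma> < uniform_exponent 1 \<Theta> \<or> \<gamma> = \<kappa>"
  shows "dominated \<gamma>"
  using assms(2)
proof
  assume "ereal \<gamma> < uniform_exponent 1 \<Theta>"
  then obtain \<gamma>' where \<gamma>': "uniform_admissible 1 \<Theta> \<gamma>'" "\<gamma> < \<gamma>'"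
    unfolding uniform_exponent_def less_Sup_iff by auto
  have "-1 < \<gamma>"
    using assms(1) kappa_pos by linarith
  then show ?thesis
    using assms(1) \<gamma>'(2) kappa_pos by (intro dominated_mono[OF dominated_admissible[OF \<gamma>'(1)]]) auto
qed (simp add: dominated_kappa)

end

section \<open>Bounds for the second exponent\<close>

lemma ereal_le_at_left_limit:
  fixes f :: "real \<Rightarrow> real"
  assumes "a < r" "isCont f r" and "\<And>\<gamma>. a < \<gamma> \<Longrightarrow> \<gamma> < r \<Longrightarrow> ereal (f \<gamma>) \<le> x"
  shows "ereal (f r) \<le> x"
proof (rule tendsto_upperbound)
  show "((\<lambda>\<gamma>. ereal (f \<gamma>)) \<longlongrightarrow> ereal (f r)) (at_left r)"
    using assms(2) by (intro tendsto_intros) (simp add: isCont_def filterlim_at_split)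
  show "\<forall>\<^sub>F \<gamma> in at_left r. ereal (f \<gamma>) \<le> x"
    using assms(1,3) by (auto simp: eventually_at_left intro!: exI[of _ a])
qed simp

context theta_matrix
begin

text \<open>The factor \<open>P\<close> cancels and leaves q / N - 1. For m = 1 the numerator N
  splits as R + q, so that subtracting 1 + \<kappa> leaves w = P R / q, which is positive for
  \<gamma> < 1.\<close>

lemma exponent_two_ge_of_dominated:
  assumes dom: "dominated \<gamma>" and \<gamma>: "\<kappa> \<le> \<gamma>" and d3: "3 \<le> d"
  shows "m = 1 \<Longrightarrow> \<gamma> < 1 \<Longrightarrow>
      ereal ((real n - \<gamma>) / ((real n - 1) * (1 - \<gamma>)) - 1) \<le> uniform_exponent 2 \<Theta>"
    and "2 \<le> m \<Longrightarrow> \<gamma> \<le> 1 \<Longrightarrow>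
      ereal ((real n - 1) * (\<gamma> - 1) / (real n * (1 - \<gamma>) + (real d - 2))) \<le> uniform_exponent 2 \<Theta>"
    and "2 \<le> m \<Longrightarrow> 1 < \<gamma> \<Longrightarrow>
      ereal ((real m - 1) * (\<gamma> - 1) / (real n * \<gamma> + real m - 2)) \<le> uniform_exponent 2 \<Theta>"
proof -
  define P where "P = real d / real n"
  have P: "0 < P" "1 + \<kappa> = P"
    using n_pos by (simp_all add: P_def kappa_plus_one)
  have \<gamma>0: "0 \<le> \<gamma>"
    using \<gamma> kappa_pos by linarith
  have slope: "2 + joint_slope (real d) \<kappa> \<gamma> = P *
    (if \<gamma> \<le> 1 then (real n * (1 - \<gamma>) + (real d - 2)) / (real d - 1 - \<gamma>)
     else (real n * \<gamma> + real m - 2) / ((real d - 1) * \<gamma> - 1))"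
    using joint_slope_formula[of "real m" "real n" \<gamma>] m_pos n_pos d3 \<gamma>0
    by (simp add: P_def \<kappa>_def)
  show "ereal ((real n - \<gamma>) / ((real n - 1) * (1 - \<gamma>)) - 1) \<le> uniform_exponent 2 \<Theta>"
    if m1: "m = 1" and \<gamma>1: "\<gamma> < 1"
  proof -
    define q where "q = real n - \<gamma>"
    define R where "R = (real n - 1) * (1 - \<gamma>)"
    have n2: "2 \<le> real n"
      using d3 m1 by simp
    then have q: "0 < q" "0 < R"
      using \<gamma>1 by (simp_all add: q_def R_def)
    have "(real n * (1 - \<gamma>) + (real d - 2)) / (real d - 1 - \<gamma>) = (R + q) / q"
      using m1 by (simp add: R_def q_def algebra_simps)
    then have "2 + joint_slope (real d) \<kappa> \<gamma> - (if m = 1 then 1 + \<kappa> else 0) = P * (R / q)"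
      using slope \<gamma>1 m1 q(1) unfolding P(2) by (simp add: add_divide_distrib algebra_simps)
    then have "ereal ((1 + \<kappa>) / (P * (R / q)) - 1) \<le> uniform_exponent 2 \<Theta>"
      using P(1) q by (intro exponent_two_ge[OF dom \<gamma> d3]) auto
    then show ?thesis
      using P(1) unfolding P(2) by (simp add: q_def R_def)
  qed
  have general: "ereal (q / N - 1) \<le> uniform_exponent 2 \<Theta>"
    if "2 \<le> m" "2 + joint_slope (real d) \<kappa> \<gamma> = P * (N / q)" "0 < N" "0 < q" for N q
  proof -
    have "ereal ((1 + \<kappa>) / (P * (N / q)) - 1) \<le> uniform_exponent 2 \<Theta>"
      using P(1) that by (intro exponent_two_ge[OF dom \<gamma> d3]) auto
    then show ?thesis
      using P(1) unfolding P(2) by simp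
  qed
  show "ereal ((real n - 1) * (\<gamma> - 1) / (real n * (1 - \<gamma>) + (real d - 2))) \<le> uniform_exponent 2 \<Theta>"
    if m2: "2 \<le> m" and \<gamma>1: "\<gamma> \<le> 1"
  proof -
    define N where "N = real n * (1 - \<gamma>) + (real d - 2)"
    define q where "q = real d - 1 - \<gamma>"
    have "0 \<le> real n * (1 - \<gamma>)" "3 \<le> real d"
      using \<gamma>1 d3 by auto
    then have N: "0 < N" "0 < q"
      using \<gamma>1 unfolding N_def q_def by linarith+
    then have "ereal (q / N - 1) \<le> uniform_exponent 2 \<Theta>"
      using slope \<gamma>1 m2 by (intro general) (simp_all only: N_def q_def if_True)
    also have "q / N - 1 = (q - N) / N"
      using N by (simp add: diff_divide_distrib)
    also have "q - N = (real n - 1) * (\<gamma> - 1)"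
      by (simp add: N_def q_def algebra_simps)
    finally show ?thesis
      by (simp only: N_def)
  qed
  show "ereal ((real m - 1) * (\<gamma> - 1) / (real n * \<gamma> + real m - 2)) \<le> uniform_exponent 2 \<Theta>"
    if m2: "2 \<le> m" and \<gamma>1: "1 < \<gamma>"
  proof -
    define N where "N = real n * \<gamma> + real m - 2"
    define q where "q = (real d - 1) * \<gamma> - 1"
    have "2 \<le> real m" "1 * 1 \<le> real n * \<gamma>"
      using m2 n_pos \<gamma>1 by (simp, intro mult_mono) auto
    moreover have "2 * 1 \<le> (real d - 1) * \<gamma>"
      using d3 \<gamma>1 by (intro mult_mono) auto
    ultimately have N: "0 < N" "0 < q"
      unfolding N_def q_def by linarith+
    have "2 + joint_slope (real d) \<kappa> \<gamma> = P * (N / q)"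
      using slope \<gamma>1 by (simp add: N_def q_def)
    then have "ereal (q / N - 1) \<le> uniform_exponent 2 \<Theta>"
      using N m2 by (intro general) auto
    also have "q / N - 1 = (q - N) / N"
      using N by (simp add: diff_divide_distrib)
    also have "q - N = (real m - 1) * (\<gamma> - 1)"
      by (simp add: N_def q_def algebra_simps)
    finally show ?thesis
      by (simp only: N_def)
  qed
qed

text \<open>If r = \<kappa>, there is nothing to approach r from, and \<open>dominated_kappa\<close>
  gives the bound at r directly. The parameter \<open>a\<close> keeps \<gamma> in the range where
  the formula \<open>f\<close> is valid.\<close>

lemma exponent_two_ge_at_exponent_one:
  fixes f :: "real \<Rightarrow> real"
  assumes \<alpha>: "uniform_exponent 1 \<Theta> = ereal r" and "isCont f r" and "a < r"
    and bound: "\<And>\<gamma>. dominated \<gamma> \<Longrightarrow> \<kappa> \<le> \<gamma> \<Longrightarrow> a < \<gamma> \<Longrightarrow> \<gamma> \<le> r \<Longrightarrow> ereal (f \<gamma>) \<le> x"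
  shows "ereal (f r) \<le> x"
proof (cases "r = \<kappa>")
  case True
  then show ?thesis
    using bound[OF dominated_kappa] \<open>a < r\<close> by simp
next
  case False
  then have "\<kappa> < r"
    using exponent_one_ge unfolding \<alpha> by simp
  moreover have "dominated \<gamma>" if "\<kappa> \<le> \<gamma>" "\<gamma> < r" for \<gamma>
    using that by (intro dominated_below_exponent) (simp_all only: \<alpha> less_ereal.simps simp_thms)
  ultimately show ?thesis
    using assms(2,3) by (intro ereal_le_at_left_limit[of "max a \<kappa>" r f] bound) auto
qed

text \<open>At \<alpha> = 1 the inverse is infinite, so the second exponent must exceed every real.
  For larger \<alpha>, infinity included, the bound is nonpositive and \<open>nonneg\<close>
  suffices.\<close>

lemma exponent_two_ge_row:
  assumes \<alpha>: "uniform_exponent 1 \<Theta> = \<alpha>" and m1: "m = 1" and d3: "3 \<le> d"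
  shows "inverse (1 - \<alpha>) - ereal ((real n - 2) / (real n - 1)) \<le> uniform_exponent 2 \<Theta>"
proof -
  have n2: "2 \<le> real n"
    using d3 m1 by simp
  have "real m = 1"
    using m1 by simp
  then have \<kappa>_eq: "\<kappa> = 1 / real n"
    unfolding \<kappa>_def by (simp only:)
  have \<kappa>: "\<kappa> < 1"
    unfolding \<kappa>_eq using n2 by simp
  have nonneg: "0 \<le> uniform_exponent 2 \<Theta>"
  proof -
    have "(real n - 1) * (1 - \<kappa>) \<le> (real n - 1) * 1"
      using n2 kappa_pos by (intro mult_left_mono) auto
    also have "\<dots> \<le> real n - \<kappa>"
      using \<kappa> by simp
    finally have "(real n - 1) * (1 - \<kappa>) \<le> real n - \<kappa>" .
    then have "0 \<le> (real n - \<kappa>) / ((real n - 1) * (1 - \<kappa>)) - 1"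
      using n2 \<kappa> by (simp add: le_divide_eq)
    then have "0 \<le> ereal ((real n - \<kappa>) / ((real n - 1) * (1 - \<kappa>)) - 1)"
      by simp
    then show ?thesis
      using exponent_two_ge_of_dominated(1)[OF dominated_kappa order.refl d3 m1 \<kappa>] by (rule order.trans)
  qed
  have quot: "(real n - 2) / (real n - 1) = 1 - 1 / (real n - 1)" "0 \<le> (real n - 2) / (real n - 1)"
    using n2 by (simp_all add: field_simps)
  have "ereal \<kappa> \<le> \<alpha>"
    using exponent_one_ge unfolding \<alpha> .
  then consider (inf) "\<alpha> = \<infinity>" | (real) r where "\<alpha> = ereal r" "\<kappa> \<le> r"
    by (cases \<alpha>) auto
  then show ?thesis
  proof cases
    case inf
    have "inverse (1 - \<alpha>) - ereal ((real n - 2) / (real n - 1)) = ereal (- ((real n - 2) / (real n - 1)))"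
      by (simp add: inf one_ereal_def)
    also have "\<dots> \<le> 0"
      using quot(2) by simp
    finally show ?thesis
      using nonneg by (rule order.trans)
  next
    case real
    consider "r < 1" | "r = 1" | "1 < r"
      by linarith
    then show ?thesis
    proof cases
      case 1
      let ?f = "\<lambda>\<gamma>. (real n - \<gamma>) / ((real n - 1) * (1 - \<gamma>)) - 1"
      have "ereal (?f r) \<le> uniform_exponent 2 \<Theta>"
      proof (rule exponent_two_ge_at_exponent_one[OF \<alpha>[unfolded real(1)]])
        show "isCont ?f r"
          using 1 n2 by (intro continuous_intros) auto
        show "r - 1 < r"
          by simp
        show "ereal (?f \<gamma>) \<le> uniform_exponent 2 \<Theta>" if "dominated \<gamma>" "\<kappa> \<le> \<gamma>" "\<gamma> \<le> r" for \<gamma>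
          using that 1 by (intro exponent_two_ge_of_dominated(1) d3 m1) auto
      qed
      moreover have "(real n - r) / ((real n - 1) * (1 - r)) = inverse (1 - r) + 1 / (real n - 1)"
        using 1 n2 by (simp add: divide_simps)
      then have "inverse (1 - r) - (real n - 2) / (real n - 1) = ?f r"
        unfolding quot(1) by simp
      ultimately show ?thesis
        using 1 by (simp add: real(1) one_ereal_def)
    next
      case 2
      have "ereal B \<le> uniform_exponent 2 \<Theta>" for B
      proof -
        \<comment> \<open>Close enough to 1 for 1 / (1 - \<gamma>) to reach
          \<open>\<bar>B\<bar> + 1\<close>, yet not below \<kappa>.\<close>
        define \<gamma> where "\<gamma> = max \<kappa> (1 - 1 / (\<bar>B\<bar> + 1))"
        have \<gamma>: "\<kappa> \<le> \<gamma>" "\<gamma> < 1" "1 - \<gamma> \<le> 1 / (\<bar>B\<bar> + 1)"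
          using \<kappa> by (auto simp: \<gamma>_def)
        have "\<bar>B\<bar> + 1 \<le> 1 / (1 - \<gamma>)"
          using \<gamma>(2,3) by (simp add: field_simps)
        also have "\<dots> \<le> (real n - \<gamma>) / (real n - 1) / (1 - \<gamma>)"
          using \<gamma>(2) n2 by (intro divide_right_mono) auto
        finally have "B \<le> (real n - \<gamma>) / ((real n - 1) * (1 - \<gamma>)) - 1"
          by simp
        then have "ereal B \<le> ereal ((real n - \<gamma>) / ((real n - 1) * (1 - \<gamma>)) - 1)"
          by simp
        moreover have "dominated \<gamma>"
          using \<gamma>(1,2) 2 by (intro dominated_below_exponent) (simp_all only: \<alpha> real(1) less_ereal.simps simp_thms)
        ultimately show ?thesis
          using exponent_two_ge_of_dominated(1)[OF _ \<gamma>(1) d3 m1 \<gamma>(2)] by (meson order.trans)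
      qed
      then show ?thesis
        using ereal_top[of "uniform_exponent 2 \<Theta>"] by simp
    next
      case 3
      then have inv: "inverse (1 - r) \<le> 0"
        by simp
      have "inverse (1 - \<alpha>) - ereal ((real n - 2) / (real n - 1))
          = ereal (inverse (1 - r) - (real n - 2) / (real n - 1))"
        using 3 by (simp add: real(1) one_ereal_def)
      also have "\<dots> \<le> 0"
        using order.trans[OF inv quot(2)] by simp
      finally show ?thesis
        using nonneg by (rule order.trans)
    qed
  qed
qed

text \<open>The bound is \<open>?f r\<close> with numerator and denominator divided by r - 1. At r =
  1 the inverse is infinite and, as \<open>c\<close> is positive, the quotient is 0, which is also
  the value of \<open>?f\<close>.\<close>

lemma exponent_two_ge_low:
  assumes \<alpha>: "uniform_exponent 1 \<Theta> = \<alpha>" and m2: "2 \<le> m" and d3: "3 \<le> d" and le: "\<alpha> \<le> 1"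
  shows "ereal (real n - 1) / (- ereal (real n) - ereal (real d - 2) * inverse (1 - \<alpha>))
    \<le> uniform_exponent 2 \<Theta>"
proof -
  define c where "c = real d - 2"
  have "ereal \<kappa> \<le> \<alpha>"
    using exponent_one_ge unfolding \<alpha> .
  then obtain r where r: "\<alpha> = ereal r" "r \<le> 1"
    using le by (cases \<alpha>) (auto simp: one_ereal_def)
  let ?N = "\<lambda>\<gamma>. real n * (1 - \<gamma>) + c"
  let ?f = "\<lambda>\<gamma>. (real n - 1) * (\<gamma> - 1) / ?N \<gamma>"
  have c: "0 < c" and N: "0 < ?N r"
    using d3 r(2) by (auto simp: c_def intro!: add_nonneg_pos)
  have f: "ereal (?f r) \<le> uniform_exponent 2 \<Theta>"
  proof (rule exponent_two_ge_at_exponent_one[OF \<alpha>[unfolded r(1)]])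
    show "isCont ?f r"
      using N by (intro continuous_intros) auto
    show "r - 1 < r"
      by simp
    show "ereal (?f \<gamma>) \<le> uniform_exponent 2 \<Theta>" if "dominated \<gamma>" "\<kappa> \<le> \<gamma>" "\<gamma> \<le> r" for \<gamma>
      using that r(2) unfolding c_def by (intro exponent_two_ge_of_dominated(2) d3 m2) auto
  qed
  show ?thesis
  proof (cases "r = 1")
    case True
    then show ?thesis
      using f c unfolding c_def[symmetric] by (simp add: r(1) one_ereal_def[symmetric] zero_ereal_def[symmetric])
  next
    case False
    then have r1: "0 < 1 - r"
      using r(2) by simp
    then have den: "- real n - c * inverse (1 - r) = - (?N r / (1 - r))"
      by (simp add: field_simps)
    have neg: "r - 1 = - (1 - r)"
      by simp
    have "(real n - 1) / (- real n - c * inverse (1 - r)) = ?f r"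
      unfolding den neg
      by (simp only: divide_minus_right divide_divide_eq_right mult_minus_right minus_divide_left)
    moreover have "- real n - c * inverse (1 - r) \<noteq> 0"
      unfolding den using N r1 by simp
    ultimately show ?thesis
      using f False unfolding c_def[symmetric] by (simp add: r(1) one_ereal_def)
  qed
qed

lemma exponent_two_ge_high:
  assumes \<alpha>: "uniform_exponent 1 \<Theta> = \<alpha>" and m2: "2 \<le> m" and d3: "3 \<le> d" and ge: "1 \<le> \<alpha>"
  shows "ereal (real m - 1) / (ereal (real n) + ereal (real d - 2) * inverse (\<alpha> - 1))
    \<le> uniform_exponent 2 \<Theta>"
proof -
  define c where "c = real d - 2"
  let ?N = "\<lambda>\<gamma>. real n * \<gamma> + real m - 2"
  let ?f = "\<lambda>\<gamma>. (real m - 1) * (\<gamma> - 1) / ?N \<gamma>"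
  have c: "0 < c" and mn: "2 \<le> real m" "1 \<le> real n"
    using d3 m2 n_pos by (auto simp: c_def)
  consider (inf) "\<alpha> = \<infinity>" | (one) "\<alpha> = 1" | (real) r where "\<alpha> = ereal r" "1 < r"
    using ge by (cases \<alpha>) (force simp: one_ereal_def)+
  then show ?thesis
  proof cases
    case inf
    have "ereal ((real m - 1) / real n) \<le> uniform_exponent 2 \<Theta>"
    proof (rule tendsto_upperbound)
      \<comment> \<open>\<open>?f\<close> with numerator and denominator divided by \<gamma>. Its
        limit is the claimed bound, since the inverse of infinity is 0.\<close>
      have "((\<lambda>\<gamma>. (real m - 1) * (1 - 1 / \<gamma>) / (real n + (real m - 2) / \<gamma>))
          \<longlongrightarrow> (real m - 1) * (1 - 0) / (real n + 0)) at_top"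
        using mn by (intro tendsto_intros tendsto_divide_0[OF tendsto_const] filterlim_at_top_imp_at_infinity
            filterlim_ident) auto
      moreover have "\<forall>\<^sub>F \<gamma> in at_top. (real m - 1) * (1 - 1 / \<gamma>) / (real n + (real m - 2) / \<gamma>) = ?f \<gamma>"
        using eventually_gt_at_top[of 0]
      proof eventually_elim
        case (elim \<gamma>)
        have "1 - 1 / \<gamma> = (\<gamma> - 1) / \<gamma>" "real n + (real m - 2) / \<gamma> = ?N \<gamma> / \<gamma>"
          using elim by (simp_all add: field_simps)
        then show ?case
          using elim by simp
      qed
      ultimately have "(?f \<longlongrightarrow> (real m - 1) / real n) at_top"
        by (simp add: tendsto_cong)
      then show "((\<lambda>\<gamma>. ereal (?f \<gamma>)) \<longlongrightarrow> ereal ((real m - 1) / real n)) at_top"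
        by (rule tendsto_ereal)
      show "\<forall>\<^sub>F \<gamma> in at_top. ereal (?f \<gamma>) \<le> uniform_exponent 2 \<Theta>"
        using eventually_gt_at_top[of "max \<kappa> 1"]
      proof eventually_elim
        case (elim \<gamma>)
        then have "\<kappa> \<le> \<gamma>" "1 < \<gamma>"
          by auto
        moreover have "ereal \<gamma> < uniform_exponent 1 \<Theta>"
          unfolding \<alpha> inf by simp
        ultimately show ?case
          by (intro exponent_two_ge_of_dominated(3) dominated_below_exponent d3 m2) blast+
      qed
    qed simp
    then show ?thesis
      using mn by (simp add: inf)
  next
    case one
    \<comment> \<open>At 1 the denominators of both bounds are infinite, so both bounds are 0 and
      the low case applies.\<close>
    have "0 = ereal (real n - 1) / (- ereal (real n) - ereal (real d - 2) * inverse (1 - \<alpha>))"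
      using c unfolding c_def[symmetric] by (simp add: one one_ereal_def[symmetric])
    also have "\<dots> \<le> uniform_exponent 2 \<Theta>"
      by (rule exponent_two_ge_low[OF \<alpha> m2 d3]) (simp add: one)
    finally show ?thesis
      using c unfolding c_def[symmetric] by (simp add: one one_ereal_def[symmetric])
  next
    case real
    have "1 * 1 \<le> real n * r"
      using mn real(2) by (intro mult_mono) auto
    then have N: "0 < ?N r"
      using mn by linarith
    have f: "ereal (?f r) \<le> uniform_exponent 2 \<Theta>"
    proof (rule exponent_two_ge_at_exponent_one[OF \<alpha>[unfolded real(1)]])
      show "isCont ?f r"
        using N by (intro continuous_intros) auto
      show "1 < r"
        by (rule real(2))
      show "ereal (?f \<gamma>) \<le> uniform_exponent 2 \<Theta>" if "dominated \<gamma>" "\<kappa> \<le> \<gamma>" "1 < \<gamma>" for \<gamma>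
        using that by (intro exponent_two_ge_of_dominated(3) d3 m2)
    qed
    have den: "real n + c * inverse (r - 1) = ?N r / (r - 1)"
      using real(2) by (simp add: c_def field_simps)
    then have "(real m - 1) / (real n + c * inverse (r - 1)) = ?f r"
      by simp
    moreover have "real n + c * inverse (r - 1) \<noteq> 0"
      unfolding den using N real(2) by simp
    ultimately show ?thesis
      using f real(2) unfolding c_def[symmetric] by (simp add: real(1) one_ereal_def)
  qed
qed

end

theorem theorem3:
  fixes n m d :: nat and \<Theta> :: "real mat" and \<alpha>\<^sub>1 \<alpha>\<^sub>2 :: ereal
  assumes "n \<ge> 1" and "m \<ge> 1" and "n + m \<ge> 3" and "d = m + n"
    and "\<Theta> \<in> carrier_mat n m"
    and "\<alpha>\<^sub>1 = uniform_exponent 1 \<Theta>" and "\<alpha>\<^sub>2 = uniform_exponent 2 \<Theta>"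
  shows "(m = 1 \<longrightarrow>
            \<alpha>\<^sub>2 \<ge> inverse (1 - \<alpha>\<^sub>1) - ereal ((real n - 2) / (real n - 1))) \<and>
         (m \<ge> 2 \<longrightarrow>
            (\<alpha>\<^sub>1 \<le> 1 \<longrightarrow>
               \<alpha>\<^sub>2 \<ge> ereal (real n - 1) /
                     (- ereal (real n) - ereal (real d - 2) * inverse (1 - \<alpha>\<^sub>1))) \<and>
            (\<alpha>\<^sub>1 \<ge> 1 \<longrightarrow>
               \<alpha>\<^sub>2 \<ge> ereal (real m - 1) /
                     (ereal (real n) + ereal (real d - 2) * inverse (\<alpha>\<^sub>1 - 1))))"
proof -
  interpret theta_matrix n m \<Theta>
    using assms(1,2,5) by unfold_locales
  have "3 \<le> m + n"
    using assms(3) by simp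
  then show ?thesis
    unfolding assms(4,7)
    using exponent_two_ge_row exponent_two_ge_low exponent_two_ge_high assms(6)[symmetric] by blast
qed

end
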